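(* Let $(W,S)$ be a Coxeter system of finite rank with $S=\{s_1,\dots,s_n\}$ and all $m_{ij}=m_{s_is_j}<\infty$. Let $V$ be an IR-representation of $(W,S)$ defined by the datum $(k_{ij},a_i^j)_{i\neq j}$, let $\widetilde G$ be the associated graph, and let $A\in \mathrm M_n(\mathbb{C})$ be the matrix with diagonal entries $1$ and $(i,j)$-entry $-\frac{a_i^j}{a_j^i}\cos\frac{k_{ij}\pi}{m_{ij}}$ for $i\ne j$. Suppose $\widetilde G$ is connected. Then: (1) $V$ is indecomposable, and $V$ is irreducible if and only if $A$ is invertible. (2) If $V$ is reducible, and $V_0$ is its maximal sub-representation, then the quotient $V/V_0$ is irreducible of dimension $\operatorname{rank}(A)$. In general (without assuming $\widetilde G$ connected), $V$ is semisimple if and only if $A$ is invertible.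
   Context: $W=\langle S\mid s^2=(st)^{m_{st}}=e,\ \forall s\ne t\in S\rangle$. All representations are complex. IR-representation: a representation $V$ of $W$ having a basis $\{\alpha_s\mid s\in S\}$ such that for every $s\in S$ there is a subspace $H_s\subset V$ of codimension $1$ with $s|_{H_s}=\mathrm{Id}$, and $s\cdot\alpha_s=-\alpha_s$. Write $\alpha_i=\alpha_{s_i}$. Every IR-representation is defined by a datum $(k_{ij},a_i^j)_{i\ne j}$ with $k_{ij}=k_{ji}\in\mathbb{N}$, $1\le k_{ij}\le m_{ij}/2$, $a_i^j\in\mathbb{C}^\times$, through $$s_i\cdot\alpha_i=-\alpha_i,\qquad s_i\cdot\alpha_j=\alpha_j+2\frac{a_i^j}{a_j^i}\cos\frac{k_{ij}\pi}{m_{ij}}\,\alpha_i\quad(j\ne i).$$ $\widetilde G$ is the graph with vertex set $S$ in which $\{s_i,s_j\}$ is an edge iff $m_{ij}/\gcd(m_{ij},k_{ij})\ge 3$ (equivalently $k_{ij}\neq m_{ij}/2$). When $\widetilde G$ is connected and $V$ is reducible, $V$ has a unique maximal (proper) sub-representation $V_0$, which has trivial $W$-action. *)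

theory Defs
  imports Complex_Main "HOL-Algebra.Generated_Groups" "HOL-Algebra.QuotRing"
    "Jordan_Normal_Form.DL_Rank" "Graph_Theory.Graph_Theory"
begin

section \<open>Coxeter systems\<close>

text \<open>Words in the letters \<open>X\<close> and their formal inverses; \<open>(x, False)\<close> stands for the inverse of \<open>x\<close>.
  The relation \<open>pres_cong X R\<close> is equality in the free group on \<open>X\<close> modulo the normal closure of \<open>R\<close>.\<close>

inductive pres_cong :: "'i set \<Rightarrow> ('i \<times> bool) list set \<Rightarrow> ('i \<times> bool) list \<Rightarrow> ('i \<times> bool) list \<Rightarrow> bool"
  for X R where
  refl: "pres_cong X R w w"
| sym: "pres_cong X R w w' \<Longrightarrow> pres_cong X R w' w"
| trans: "pres_cong X R u v \<Longrightarrow> pres_cong X R v w \<Longrightarrow> pres_cong X R u w"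
| cancel: "x \<in> X \<Longrightarrow> pres_cong X R (u @ [(x, b), (x, \<not> b)] @ v) (u @ v)"
| relator: "r \<in> R \<Longrightarrow> pres_cong X R (u @ r @ v) (u @ v)"

fun word_value :: "('g, 'a) monoid_scheme \<Rightarrow> ('i \<Rightarrow> 'g) \<Rightarrow> ('i \<times> bool) list \<Rightarrow> 'g" where
  "word_value G f [] = \<one>\<^bsub>G\<^esub>"
| "word_value G f ((x, b) # w) = (if b then f x else inv\<^bsub>G\<^esub> (f x)) \<otimes>\<^bsub>G\<^esub> word_value G f w"

text \<open>\<open>G\<close> is presented by generators \<open>X\<close> (realised in \<open>G\<close> through \<open>f\<close>) and relators \<open>R\<close>: the
  homomorphism from the free group on \<open>X\<close> modulo the normal closure of \<open>R\<close> to \<open>G\<close> is bijective.\<close>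

definition has_presentation ::
  "('g, 'a) monoid_scheme \<Rightarrow> 'i set \<Rightarrow> ('i \<times> bool) list set \<Rightarrow> ('i \<Rightarrow> 'g) \<Rightarrow> bool" where
  "has_presentation G X R f \<longleftrightarrow>
     group G \<and> f ` X \<subseteq> carrier G \<and> generate G (f ` X) = carrier G \<and>
     (\<forall>w w'. set w \<subseteq> X \<times> UNIV \<longrightarrow> set w' \<subseteq> X \<times> UNIV \<longrightarrow>
        (word_value G f w = word_value G f w' \<longleftrightarrow> pres_cong X R w w'))"

definition coxeter_relators :: "nat \<Rightarrow> (nat \<Rightarrow> nat \<Rightarrow> nat) \<Rightarrow> (nat \<times> bool) list set" where
  "coxeter_relators n m =
     {[(i, True), (i, True)] | i. i < n} \<union>
     {concat (replicate (m i j) [(i, True), (j, True)]) | i j. i < n \<and> j < n \<and> i \<noteq> j}"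

text \<open>The generators are indexed by \<open>{0..<n}\<close> instead of \<open>{1..n}\<close>. The entries \<open>m i j\<close> are natural
  numbers, so all of them are finite; the values \<open>m i i\<close> play no role.\<close>

definition coxeter_system ::
  "('g, 'a) monoid_scheme \<Rightarrow> nat \<Rightarrow> (nat \<Rightarrow> 'g) \<Rightarrow> (nat \<Rightarrow> nat \<Rightarrow> nat) \<Rightarrow> bool" where
  "coxeter_system W n s m \<longleftrightarrow>
     (\<forall>i<n. \<forall>j<n. i \<noteq> j \<longrightarrow> m i j = m j i \<and> 2 \<le> m i j) \<and>
     has_presentation W {..<n} (coxeter_relators n m) s"

section \<open>Complex representations\<close>

locale complex_representation =
  fixes G :: "('g, 'a) monoid_scheme"
    and V :: "(complex, 'v, 'b) module_scheme"
    and \<rho> :: "'g \<Rightarrow> 'v \<Rightarrow> 'v"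
  assumes group: "group G"
    and vectorspace: "vectorspace class_ring V"
    and linear: "g \<in> carrier G \<Longrightarrow> linear_map class_ring V V (\<rho> g)"
    and act_one: "v \<in> carrier V \<Longrightarrow> \<rho> \<one>\<^bsub>G\<^esub> v = v"
    and act_mult: "g \<in> carrier G \<Longrightarrow> h \<in> carrier G \<Longrightarrow> v \<in> carrier V \<Longrightarrow>
      \<rho> (g \<otimes>\<^bsub>G\<^esub> h) v = \<rho> g (\<rho> h v)"

definition subrep where
  "subrep G V \<rho> U \<longleftrightarrow>
     VectorSpace.subspace (class_ring :: complex ring) U V \<and>
     (\<forall>g \<in> carrier G. \<forall>u \<in> U. \<rho> g u \<in> U)"

definition irreducible_rep where
  "irreducible_rep G V \<rho> \<longleftrightarrow>
     complex_representation G V \<rho> \<and> carrier V \<noteq> {\<zero>\<^bsub>V\<^esub>} \<and>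
     (\<forall>U. subrep G V \<rho> U \<longrightarrow> U = {\<zero>\<^bsub>V\<^esub>} \<or> U = carrier V)"

definition indecomposable_rep where
  "indecomposable_rep G V \<rho> \<longleftrightarrow>
     complex_representation G V \<rho> \<and> carrier V \<noteq> {\<zero>\<^bsub>V\<^esub>} \<and>
     (\<forall>U U'. subrep G V \<rho> U \<longrightarrow> subrep G V \<rho> U' \<longrightarrow>
        U \<inter> U' = {\<zero>\<^bsub>V\<^esub>} \<longrightarrow> U <+>\<^bsub>V\<^esub> U' = carrier V \<longrightarrow>
        U = {\<zero>\<^bsub>V\<^esub>} \<or> U' = {\<zero>\<^bsub>V\<^esub>})"

text \<open>A representation is semisimple if it is the internal direct sum of a (possibly empty) family
  of irreducible subrepresentations. As these are nonzero, the members of such a family are pairwise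
  distinct, so the family can be given as a set.\<close>

definition semisimple_rep where
  "semisimple_rep G V \<rho> \<longleftrightarrow>
     complex_representation G V \<rho> \<and>
     (\<exists>\<U>. (\<forall>U \<in> \<U>. subrep G V \<rho> U \<and> irreducible_rep G (V\<lparr>carrier := U\<rparr>) \<rho>) \<and>
          LinearCombinations.module.span class_ring V (\<Union>\<U>) = carrier V \<and>
          (\<forall>U \<in> \<U>. U \<inter> LinearCombinations.module.span class_ring V (\<Union>(\<U> - {U})) = {\<zero>\<^bsub>V\<^esub>}))"

definition maximal_subrep where
  "maximal_subrep G V \<rho> U \<longleftrightarrow>
     subrep G V \<rho> U \<and> U \<noteq> carrier V \<and>
     (\<forall>U'. subrep G V \<rho> U' \<longrightarrow> U' \<noteq> carrier V \<longrightarrow> U \<subseteq> U' \<longrightarrow> U' = U)"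

text \<open>The ring multiplication and unit that every module record carries are irrelevant.\<close>

definition quotient_space ::
  "(complex, 'v, 'b) module_scheme \<Rightarrow> 'v set \<Rightarrow> (complex, 'v set) module" where
  "quotient_space V U =
     \<lparr>carrier = a_rcosets\<^bsub>V\<^esub> U, monoid.mult = undefined, one = undefined, zero = U, add = (<+>\<^bsub>V\<^esub>),
      smult = (\<lambda>c X. \<Union>x\<in>X. U +>\<^bsub>V\<^esub> (c \<odot>\<^bsub>V\<^esub> x))\<rparr>"

definition quotient_action ::
  "(complex, 'v, 'b) module_scheme \<Rightarrow> 'v set \<Rightarrow> ('g \<Rightarrow> 'v \<Rightarrow> 'v) \<Rightarrow> 'g \<Rightarrow> 'v set \<Rightarrow> 'v set" where
  "quotient_action V U \<rho> g X = (\<Union>x\<in>X. U +>\<^bsub>V\<^esub> \<rho> g x)"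

section \<open>IR-representations\<close>

definition ir_representation ::
  "('g, 'a) monoid_scheme \<Rightarrow> nat \<Rightarrow> (nat \<Rightarrow> 'g) \<Rightarrow> (complex, 'v, 'b) module_scheme \<Rightarrow>
   ('g \<Rightarrow> 'v \<Rightarrow> 'v) \<Rightarrow> (nat \<Rightarrow> 'v) \<Rightarrow> bool" where
  "ir_representation W n s V \<rho> \<alpha> \<longleftrightarrow>
     complex_representation W V \<rho> \<and>
     inj_on \<alpha> {..<n} \<and> vectorspace.basis class_ring V (\<alpha> ` {..<n}) \<and>
     (\<forall>i<n. (\<exists>H. VectorSpace.subspace class_ring H V \<and>
                vectorspace.dim class_ring (quotient_space V H) = 1 \<and>
                (\<forall>v\<in>H. \<rho> (s i) v = v)) \<and>
            \<rho> (s i) (\<alpha> i) = \<ominus>\<^bsub>V\<^esub> \<alpha> i)"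

text \<open>\<open>a i j\<close> is the number with lower index \<open>i\<close> and upper index \<open>j\<close>.\<close>

definition ir_datum ::
  "nat \<Rightarrow> (nat \<Rightarrow> nat \<Rightarrow> nat) \<Rightarrow> (nat \<Rightarrow> nat \<Rightarrow> nat) \<Rightarrow> (nat \<Rightarrow> nat \<Rightarrow> complex) \<Rightarrow> bool" where
  "ir_datum n m k a \<longleftrightarrow>
     (\<forall>i<n. \<forall>j<n. i \<noteq> j \<longrightarrow>
        k i j = k j i \<and> 1 \<le> k i j \<and> real (k i j) \<le> real (m i j) / 2 \<and> a i j \<noteq> 0)"

definition ir_defined_by ::
  "nat \<Rightarrow> (nat \<Rightarrow> 'g) \<Rightarrow> (nat \<Rightarrow> nat \<Rightarrow> nat) \<Rightarrow> (complex, 'v, 'b) module_scheme \<Rightarrow>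
   ('g \<Rightarrow> 'v \<Rightarrow> 'v) \<Rightarrow> (nat \<Rightarrow> 'v) \<Rightarrow> (nat \<Rightarrow> nat \<Rightarrow> nat) \<Rightarrow> (nat \<Rightarrow> nat \<Rightarrow> complex) \<Rightarrow> bool" where
  "ir_defined_by n s m V \<rho> \<alpha> k a \<longleftrightarrow>
     (\<forall>i<n. \<rho> (s i) (\<alpha> i) = \<ominus>\<^bsub>V\<^esub> \<alpha> i \<and>
        (\<forall>j<n. j \<noteq> i \<longrightarrow>
           \<rho> (s i) (\<alpha> j) =
             \<alpha> j \<oplus>\<^bsub>V\<^esub>
             (2 * (a i j / a j i) * of_real (cos (real (k i j) * pi / real (m i j)))) \<odot>\<^bsub>V\<^esub> \<alpha> i))"

text \<open>An undirected graph is encoded as a digraph with a symmetric arc relation. The library's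
  \<open>connected\<close> requires a nonempty vertex set.\<close>

definition ir_graph ::
  "nat \<Rightarrow> (nat \<Rightarrow> nat \<Rightarrow> nat) \<Rightarrow> (nat \<Rightarrow> nat \<Rightarrow> nat) \<Rightarrow> nat pair_pre_digraph" where
  "ir_graph n m k =
     \<lparr>pverts = {..<n},
      parcs = {(i, j). i < n \<and> j < n \<and> i \<noteq> j \<and> 3 \<le> m i j div gcd (m i j) (k i j)}\<rparr>"

definition ir_matrix ::
  "nat \<Rightarrow> (nat \<Rightarrow> nat \<Rightarrow> nat) \<Rightarrow> (nat \<Rightarrow> nat \<Rightarrow> nat) \<Rightarrow> (nat \<Rightarrow> nat \<Rightarrow> complex) \<Rightarrow> complex mat" where
  "ir_matrix n m k a =
     mat n n (\<lambda>(i, j). if i = j then 1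
       else - (a i j / a j i) * of_real (cos (real (k i j) * pi / real (m i j))))"

end

theory Submission
  imports Defs
begin

text \<open>Writing \<open>v = \<Sum>\<^sub>j x\<^sub>j \<alpha>\<^sub>j\<close>, the generators act by \<open>s\<^sub>i v = v - 2 (A x)\<^sub>i \<alpha>\<^sub>i\<close>. Hence the vectors fixed by
  \<open>W\<close> correspond to the kernel of \<open>A\<close>, and a subrepresentation \<open>U\<close> that does not contain \<open>\<alpha>\<^sub>i\<close> is fixed
  pointwise by \<open>s\<^sub>i\<close>. Moreover \<open>\<alpha>\<^sub>j \<in> U\<close> forces \<open>\<alpha>\<^sub>i \<in> U\<close> for every neighbour \<open>i\<close> of \<open>j\<close>. If the graph is
  connected, a proper subrepresentation thus contains no \<open>\<alpha>\<^sub>i\<close> and lies in the fixed space, which is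
  therefore the maximal subrepresentation; the rest of (1) and (2) follows, the dimension by
  rank-nullity. In general, if \<open>A\<close> is invertible then every subrepresentation is spanned by the
  \<open>\<alpha>\<^sub>i\<close> it contains, and the connected components give a decomposition into irreducibles. Conversely,
  an irreducible summand that contains some \<open>\<alpha>\<^sub>j\<close> has no nonzero fixed vector.\<close>

section \<open>Subrepresentations and quotients\<close>

sublocale complex_representation \<subseteq> vectorspace "class_ring :: complex ring" V
  by (rule vectorspace)

context complex_representation
begin

section \<open>Linearity of the action, subspaces and restriction to a subrepresentation\<close>

lemma act_hom: "g \<in> carrier G \<Longrightarrow> \<rho> g \<in> LinearCombinations.module_hom class_ring V V"
  using linear by (meson linear_map.T_hom)

lemma act_closed [simp]: "g \<in> carrier G \<Longrightarrow> v \<in> carrier V \<Longrightarrow> \<rho> g v \<in> carrier V"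
  using act_hom module_hom_closed by blast

lemma act_add:
  "g \<in> carrier G \<Longrightarrow> v \<in> carrier V \<Longrightarrow> w \<in> carrier V \<Longrightarrow> \<rho> g (v \<oplus>\<^bsub>V\<^esub> w) = \<rho> g v \<oplus>\<^bsub>V\<^esub> \<rho> g w"
  by (rule LinearCombinations.module_hom_add[OF act_hom])

lemma act_smult:
  "g \<in> carrier G \<Longrightarrow> v \<in> carrier V \<Longrightarrow> \<rho> g (c \<odot>\<^bsub>V\<^esub> v) = c \<odot>\<^bsub>V\<^esub> \<rho> g v"
  using LinearCombinations.module_hom_smult[OF act_hom, where r = c] by simp

lemma subspace_iff:
  "VectorSpace.subspace class_ring U V \<longleftrightarrow>
    U \<subseteq> carrier V \<and> \<zero>\<^bsub>V\<^esub> \<in> U \<and> (\<forall>v\<in>U. \<forall>w\<in>U. v \<oplus>\<^bsub>V\<^esub> w \<in> U) \<and>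
    (\<forall>c. \<forall>v\<in>U. c \<odot>\<^bsub>V\<^esub> v \<in> U)"
  using vectorspace module_axioms by (auto simp: VectorSpace.subspace_def submodule_def)

lemma subspaceD:
  assumes "VectorSpace.subspace (class_ring :: complex ring) U V"
  shows "U \<subseteq> carrier V" "\<zero>\<^bsub>V\<^esub> \<in> U"
    and "\<And>v w. v \<in> U \<Longrightarrow> w \<in> U \<Longrightarrow> v \<oplus>\<^bsub>V\<^esub> w \<in> U"
    and "\<And>c v. v \<in> U \<Longrightarrow> c \<odot>\<^bsub>V\<^esub> v \<in> U"
  using assms by (simp_all add: subspace_iff)

text \<open>Through this identity closure under scalars yields closure under negation, which the
  subgroup structure behind cosets requires.\<close>

lemma minus_eq_smult: "v \<in> carrier V \<Longrightarrow> \<ominus>\<^bsub>V\<^esub> v = (-1) \<odot>\<^bsub>V\<^esub> v"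
  using smult_minus_1[of v] by (simp add: class_ring_simps)

lemma subspace_minus:
  assumes "VectorSpace.subspace (class_ring :: complex ring) U V" "v \<in> U"
  shows "\<ominus>\<^bsub>V\<^esub> v \<in> U"
  using subspaceD[OF assms(1)] assms(2) minus_eq_smult by (metis in_mono)

lemma subspace_inter:
  assumes "VectorSpace.subspace (class_ring :: complex ring) U V"
    and "VectorSpace.subspace (class_ring :: complex ring) U' V"
  shows "VectorSpace.subspace class_ring (U \<inter> U') V"
  using assms by (auto simp: subspace_iff)

lemma subspace_abelian_subgroup:
  assumes "VectorSpace.subspace (class_ring :: complex ring) U V"
  shows "abelian_subgroup U V"
proof (rule abelian_subgroupI3)
  show "additive_subgroup U V"
    unfolding additive_subgroup_def
    by (rule subgroup.intro)
      (use subspaceD[OF assms] subspace_minus[OF assms] in \<open>auto simp: a_inv_def[symmetric]\<close>)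
qed (rule abelian_group_axioms)

lemma restrict_rep:
  assumes "subrep G V \<rho> U"
  shows "complex_representation G (V\<lparr>carrier := U\<rparr>) \<rho>"
proof -
  have U: "VectorSpace.subspace class_ring U V" and inv: "\<And>g u. g \<in> carrier G \<Longrightarrow> u \<in> U \<Longrightarrow> \<rho> g u \<in> U"
    using assms by (auto simp: subrep_def)
  have vs: "vectorspace class_ring (V\<lparr>carrier := U\<rparr>)"
    using subspace_is_vs[OF U] .
  have sub: "u \<in> U \<Longrightarrow> u \<in> carrier V" for u
    using subspaceD(1)[OF U] by auto
  have mod: "Module.module class_ring (V\<lparr>carrier := U\<rparr>)"
    using vs by (simp add: vectorspace_def)
  have "\<rho> g \<in> LinearCombinations.module_hom class_ring (V\<lparr>carrier := U\<rparr>) (V\<lparr>carrier := U\<rparr>)"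
    if "g \<in> carrier G" for g
    using that by (simp add: LinearCombinations.module_hom_def inv sub act_add act_smult)
  then have "linear_map class_ring (V\<lparr>carrier := U\<rparr>) (V\<lparr>carrier := U\<rparr>) (\<rho> g)" if "g \<in> carrier G" for g
    using that vs mod by (simp add: linear_map_def mod_hom_def mod_hom_axioms_def)
  then show ?thesis
    using vs group act_one act_mult sub by (simp add: complex_representation_def)
qed

lemma subrep_restrict_iff:
  assumes "subrep G V \<rho> U"
  shows "subrep G (V\<lparr>carrier := U\<rparr>) \<rho> U' \<longleftrightarrow> subrep G V \<rho> U' \<and> U' \<subseteq> U"
proof -
  interpret R: complex_representation G "V\<lparr>carrier := U\<rparr>" \<rho>
    by (rule restrict_rep[OF assms])
  show ?thesis
    using assms by (auto simp: subrep_def subspace_iff R.subspace_iff)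
qed

text \<open>Lets irreducibility of a summand be tested among the subrepresentations of the whole of
  \<open>V\<close>, without passing to the restricted record.\<close>

lemma irreducible_restrict_iff:
  assumes "subrep G V \<rho> U"
  shows "irreducible_rep G (V\<lparr>carrier := U\<rparr>) \<rho> \<longleftrightarrow>
    U \<noteq> {\<zero>\<^bsub>V\<^esub>} \<and> (\<forall>U'. subrep G V \<rho> U' \<longrightarrow> U' \<subseteq> U \<longrightarrow> U' = {\<zero>\<^bsub>V\<^esub>} \<or> U' = U)"
  using restrict_rep[OF assms] subrep_restrict_iff[OF assms] by (auto simp: irreducible_rep_def)

lemma smult_class_ring:
  assumes "v \<in> carrier V"
  shows "(c * d) \<odot>\<^bsub>V\<^esub> v = c \<odot>\<^bsub>V\<^esub> (d \<odot>\<^bsub>V\<^esub> v)"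
    and "(c + d) \<odot>\<^bsub>V\<^esub> v = c \<odot>\<^bsub>V\<^esub> v \<oplus>\<^bsub>V\<^esub> d \<odot>\<^bsub>V\<^esub> v"
    and "1 \<odot>\<^bsub>V\<^esub> v = v"
    and "0 \<odot>\<^bsub>V\<^esub> v = \<zero>\<^bsub>V\<^esub>"
  using smult_assoc1[of c d v] smult_l_distr[of c d v] smult_one[of v] lmult_0[of v] assms by simp_all

lemma subspace_finsum:
  assumes U: "VectorSpace.subspace class_ring U V" and "finite J" "\<And>j. j \<in> J \<Longrightarrow> f j \<in> U"
  shows "(\<Oplus>\<^bsub>V\<^esub>j\<in>J. f j) \<in> U"
  using assms(2,3)
proof (induction J)
  case empty
  then show ?case
    using subspaceD(2)[OF U] by simp
next
  case (insert j J)
  then have "f \<in> insert j J \<rightarrow> carrier V"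
    using subspaceD(1)[OF U] by blast
  then show ?case
    using insert subspaceD(3)[OF U] by (simp add: Pi_iff)
qed

text \<open>Adding the negative of \<open>v\<close> isolates \<open>w\<close>. It will be used to
  extract from \<open>s\<^sub>i v\<close> in \<open>U\<close> the multiple of
  \<open>\<alpha>\<^sub>i\<close> by which it differs from \<open>v\<close>.\<close>

lemma subspace_addD:
  assumes U: "VectorSpace.subspace class_ring U V"
    and "v \<in> U" "w \<in> carrier V" "v \<oplus>\<^bsub>V\<^esub> w \<in> U"
  shows "w \<in> U"
proof -
  have v: "v \<in> carrier V"
    using assms(2) subspaceD(1)[OF U] by blast
  then have "w = \<ominus>\<^bsub>V\<^esub> v \<oplus>\<^bsub>V\<^esub> (v \<oplus>\<^bsub>V\<^esub> w)"
    using assms(3) by (simp add: M.r_neg1)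
  then show ?thesis
    using subspaceD(3)[OF U subspace_minus[OF U assms(2)] assms(4)] by simp
qed

lemma smult_eq_zero_iff:
  assumes "v \<in> carrier V" "v \<noteq> \<zero>\<^bsub>V\<^esub>"
  shows "c \<odot>\<^bsub>V\<^esub> v = \<zero>\<^bsub>V\<^esub> \<longleftrightarrow> c = 0"
proof
  assume *: "c \<odot>\<^bsub>V\<^esub> v = \<zero>\<^bsub>V\<^esub>"
  show "c = 0"
  proof (rule ccontr)
    assume "c \<noteq> 0"
    then have "v = inverse c \<odot>\<^bsub>V\<^esub> (c \<odot>\<^bsub>V\<^esub> v)"
      using assms(1) by (simp add: smult_class_ring(1)[symmetric] smult_class_ring(3))
    then show False
      using * assms(2) by simp
  qed
qed (use assms smult_class_ring(4) in simp)

lemma subspace_smultD: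
  assumes U: "VectorSpace.subspace class_ring U V" and "v \<in> carrier V" "c \<odot>\<^bsub>V\<^esub> v \<in> U" "c \<noteq> 0"
  shows "v \<in> U"
proof -
  have "v = inverse c \<odot>\<^bsub>V\<^esub> (c \<odot>\<^bsub>V\<^esub> v)"
    using assms(2,4) by (simp add: smult_class_ring(1)[symmetric] smult_class_ring(3))
  then show ?thesis
    using subspaceD(4)[OF U assms(3), of "inverse c"] by simp
qed

section \<open>Cosets, the quotient space and the quotient representation\<close>

lemma coset_eq_iff:
  assumes "VectorSpace.subspace class_ring U V" "v \<in> carrier V" "w \<in> carrier V"
  shows "U +>\<^bsub>V\<^esub> v = U +>\<^bsub>V\<^esub> w \<longleftrightarrow> v \<oplus>\<^bsub>V\<^esub> \<ominus>\<^bsub>V\<^esub> w \<in> U"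
proof -
  interpret S: abelian_subgroup U V
    by (rule subspace_abelian_subgroup[OF assms(1)])
  show ?thesis
    using abelian_subgroup.a_rcos_module[OF S.abelian_subgroup_axioms, OF assms(3,2)] M.a_repr_independence[OF _ assms(3) S.a_subgroup, of v]
      S.a_rcos_self[OF assms(2)]
    by auto
qed

text \<open>Both \<open>smult\<close> in \<open>quotient_space\<close> and \<open>quotient_action\<close> are unions of this shape.\<close>

lemma coset_union:
  assumes U: "VectorSpace.subspace class_ring U V" and v: "v \<in> carrier V"
    and f: "f \<in> LinearCombinations.module_hom class_ring V V" "\<And>u. u \<in> U \<Longrightarrow> f u \<in> U"
  shows "(\<Union>x\<in>U +>\<^bsub>V\<^esub> v. U +>\<^bsub>V\<^esub> f x) = U +>\<^bsub>V\<^esub> f v"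
proof -
  interpret S: abelian_subgroup U V
    by (rule subspace_abelian_subgroup[OF U])
  have fin: "f x \<in> carrier V" if "x \<in> carrier V" for x
    using module_hom_closed[OF f(1)] that by auto
  \<comment> \<open>A representative \<open>x = u + v\<close> changes \<open>f v\<close> only by
    \<open>f u\<close>, which stays in \<open>U\<close>, so all cosets in the union
    coincide.\<close>
  have "U +>\<^bsub>V\<^esub> f x = U +>\<^bsub>V\<^esub> f v" if x: "x \<in> U +>\<^bsub>V\<^esub> v" for x
  proof -
    obtain u where u: "u \<in> U" "x = u \<oplus>\<^bsub>V\<^esub> v"
      using x by (auto simp: a_r_coset_def')
    then have "f x = f u \<oplus>\<^bsub>V\<^esub> f v"
      using LinearCombinations.module_hom_add[OF f(1)] v S.a_subset by blast
    then have "f x \<in> U +>\<^bsub>V\<^esub> f v"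
      using f(2)[OF u(1)] by (auto simp: a_r_coset_def')
    then show ?thesis
      using M.a_repr_independence[OF _ fin[OF v] S.a_subgroup] by simp
  qed
  \<comment> \<open>The index set of the union is nonempty, since \<open>v\<close> lies in its own
    coset.\<close>
  then show ?thesis
    using S.a_rcos_self[OF v] by blast
qed

lemma smult_hom: "(\<lambda>v. c \<odot>\<^bsub>V\<^esub> v) \<in> LinearCombinations.module_hom class_ring V V"
  by (auto simp: LinearCombinations.module_hom_def smult_r_distr smult_class_ring(1)[symmetric] mult.commute)

text \<open>Reduces the set-valued operations to representatives, so that later proofs need not
  unfold the record. The zero is written as a coset too, to keep one shape throughout.\<close>

lemma quotient_space_simps:
  assumes "VectorSpace.subspace class_ring U V"
  shows "carrier (quotient_space V U) = (\<lambda>v. U +>\<^bsub>V\<^esub> v) ` carrier V"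
    and "\<zero>\<^bsub>quotient_space V U\<^esub> = U +>\<^bsub>V\<^esub> \<zero>\<^bsub>V\<^esub>"
    and "v \<in> carrier V \<Longrightarrow> w \<in> carrier V \<Longrightarrow>
      (U +>\<^bsub>V\<^esub> v) \<oplus>\<^bsub>quotient_space V U\<^esub> (U +>\<^bsub>V\<^esub> w) = U +>\<^bsub>V\<^esub> (v \<oplus>\<^bsub>V\<^esub> w)"
    and "v \<in> carrier V \<Longrightarrow> c \<odot>\<^bsub>quotient_space V U\<^esub> (U +>\<^bsub>V\<^esub> v) = U +>\<^bsub>V\<^esub> (c \<odot>\<^bsub>V\<^esub> v)"
proof -
  interpret S: abelian_subgroup U V
    by (rule subspace_abelian_subgroup[OF assms])
  show "carrier (quotient_space V U) = (\<lambda>v. U +>\<^bsub>V\<^esub> v) ` carrier V"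
    by (auto simp: quotient_space_def A_RCOSETS_def')
  show "\<zero>\<^bsub>quotient_space V U\<^esub> = U +>\<^bsub>V\<^esub> \<zero>\<^bsub>V\<^esub>"
    using S.a_subset by (simp add: quotient_space_def)
  show "(U +>\<^bsub>V\<^esub> v) \<oplus>\<^bsub>quotient_space V U\<^esub> (U +>\<^bsub>V\<^esub> w) = U +>\<^bsub>V\<^esub> (v \<oplus>\<^bsub>V\<^esub> w)"
    if "v \<in> carrier V" "w \<in> carrier V"
    using that by (simp add: quotient_space_def S.a_rcos_sum)
  show "c \<odot>\<^bsub>quotient_space V U\<^esub> (U +>\<^bsub>V\<^esub> v) = U +>\<^bsub>V\<^esub> (c \<odot>\<^bsub>V\<^esub> v)" if "v \<in> carrier V"
    using coset_union[OF assms that smult_hom[of c] subspaceD(4)[OF assms]]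
    by (simp add: quotient_space_def)
qed

lemma coset_eq_zero_iff:
  assumes "VectorSpace.subspace class_ring U V" "v \<in> carrier V"
  shows "U +>\<^bsub>V\<^esub> v = \<zero>\<^bsub>quotient_space V U\<^esub> \<longleftrightarrow> v \<in> U"
  using coset_eq_iff[OF assms, of "\<zero>\<^bsub>V\<^esub>"] assms(2)
  by (simp add: quotient_space_simps[OF assms(1)] minus_eq_smult)

lemma quotient_action_coset:
  assumes "subrep G V \<rho> U" "g \<in> carrier G" "v \<in> carrier V"
  shows "quotient_action V U \<rho> g (U +>\<^bsub>V\<^esub> v) = U +>\<^bsub>V\<^esub> \<rho> g v"
  using coset_union[of U v "\<rho> g"] assms act_hom by (simp add: quotient_action_def subrep_def)

lemma quotient_vectorspace:
  assumes "VectorSpace.subspace class_ring U V"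
  shows "vectorspace class_ring (quotient_space V U)"
proof (rule vs_criteria)
  note simps = quotient_space_simps[OF assms]
  show "field (class_ring :: complex ring)"
    by (rule class_field)
  show "\<forall>v\<in>carrier (quotient_space V U).
      \<exists>w\<in>carrier (quotient_space V U). v \<oplus>\<^bsub>quotient_space V U\<^esub> w = \<zero>\<^bsub>quotient_space V U\<^esub>"
  proof
    fix X assume "X \<in> carrier (quotient_space V U)"
    then obtain v where v: "v \<in> carrier V" "X = U +>\<^bsub>V\<^esub> v"
      by (auto simp: simps)
    then have "X \<oplus>\<^bsub>quotient_space V U\<^esub> (U +>\<^bsub>V\<^esub> \<ominus>\<^bsub>V\<^esub> v) = \<zero>\<^bsub>quotient_space V U\<^esub>"
      by (simp add: simps M.r_neg)
    then show "\<exists>w\<in>carrier (quotient_space V U). X \<oplus>\<^bsub>quotient_space V U\<^esub> w = \<zero>\<^bsub>quotient_space V U\<^esub>"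
      using v(1) unfolding simps(1) by blast
  qed
qed (auto simp: quotient_space_simps[OF assms] M.a_ac smult_r_distr smult_class_ring)

lemma quotient_map_linear:
  assumes "VectorSpace.subspace class_ring U V"
  shows "linear_map class_ring V (quotient_space V U) (\<lambda>v. U +>\<^bsub>V\<^esub> v)"
proof -
  have "(\<lambda>v. U +>\<^bsub>V\<^esub> v) \<in> LinearCombinations.module_hom class_ring V (quotient_space V U)"
    by (auto simp: LinearCombinations.module_hom_def quotient_space_simps[OF assms])
  then show ?thesis
    using vectorspace quotient_vectorspace[OF assms]
    by (simp add: linear_map_def mod_hom_def mod_hom_axioms_def vectorspace_def)
qed

text \<open>Rank-nullity for the projection, whose kernel is \<open>U\<close> and whose image is the
  whole quotient.\<close>

lemma dim_quotient:
  assumes "fin_dim" and U: "VectorSpace.subspace class_ring U V"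
  shows "vectorspace.dim class_ring (quotient_space V U) + vectorspace.dim class_ring (V\<lparr>carrier := U\<rparr>) = dim"
proof -
  interpret Q: linear_map class_ring V "quotient_space V U" "\<lambda>v. U +>\<^bsub>V\<^esub> v"
    by (rule quotient_map_linear[OF U])
  have "Q.im = carrier (quotient_space V U)"
    by (simp add: Q.im_def quotient_space_simps[OF U])
  moreover have "Q.ker = U"
    using subspaceD(1)[OF U] coset_eq_zero_iff[OF U] by (auto simp: Q.ker_def)
  ultimately show ?thesis
    using Q.rank_nullity[OF assms(1)] by simp
qed

lemma quotient_rep:
  assumes "subrep G V \<rho> U"
  shows "complex_representation G (quotient_space V U) (quotient_action V U \<rho>)"
proof -
  have U: "VectorSpace.subspace class_ring U V"
    using assms by (simp add: subrep_def)
  note simps = quotient_space_simps[OF U] quotient_action_coset[OF assms]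
  note vs = quotient_vectorspace[OF U]
  have "quotient_action V U \<rho> g
      \<in> LinearCombinations.module_hom class_ring (quotient_space V U) (quotient_space V U)"
    if "g \<in> carrier G" for g
    using that by (auto simp: LinearCombinations.module_hom_def simps act_add act_smult)
  then have "linear_map class_ring (quotient_space V U) (quotient_space V U) (quotient_action V U \<rho> g)"
    if "g \<in> carrier G" for g
    using that vs by (simp add: linear_map_def mod_hom_def mod_hom_axioms_def vectorspace_def)
  moreover have "g \<otimes>\<^bsub>G\<^esub> h \<in> carrier G" if "g \<in> carrier G" "h \<in> carrier G" for g h
    using group that by (simp add: group.is_monoid monoid.m_closed)
  moreover have "\<one>\<^bsub>G\<^esub> \<in> carrier G"
    using group by (simp add: group.is_monoid monoid.one_closed)
  ultimately show ?thesis
    using vs group by (auto simp: complex_representation_def simps act_one act_mult)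
qed

text \<open>The preimage of a subrepresentation of the quotient is a subrepresentation of
  \<open>V\<close> containing \<open>U\<close>. Maximality leaves only \<open>U\<close> and
  \<open>V\<close>, whose images are zero and the whole quotient.\<close>

lemma quotient_irreducible:
  assumes "maximal_subrep G V \<rho> U"
  shows "irreducible_rep G (quotient_space V U) (quotient_action V U \<rho>)"
proof -
  have sub: "subrep G V \<rho> U" and U: "VectorSpace.subspace class_ring U V" and ne: "U \<noteq> carrier V"
    and max: "\<And>U'. subrep G V \<rho> U' \<Longrightarrow> U \<subseteq> U' \<Longrightarrow> U' = U \<or> U' = carrier V"
    using assms by (auto simp: maximal_subrep_def subrep_def)
  note simps = quotient_space_simps[OF U] quotient_action_coset[OF sub]
  interpret Q: complex_representation G "quotient_space V U" "quotient_action V U \<rho>"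
    by (rule quotient_rep[OF sub])
  note zero_iff = coset_eq_zero_iff[OF U]
  show ?thesis
    unfolding irreducible_rep_def
  proof (intro conjI allI impI)
    show "complex_representation G (quotient_space V U) (quotient_action V U \<rho>)"
      by (rule quotient_rep[OF sub])
    obtain v where v: "v \<in> carrier V" "v \<notin> U"
      using ne subspaceD(1)[OF U] by blast
    then have "U +>\<^bsub>V\<^esub> v \<in> carrier (quotient_space V U)" "U +>\<^bsub>V\<^esub> v \<noteq> \<zero>\<^bsub>quotient_space V U\<^esub>"
      using zero_iff[OF v(1)] by (simp_all add: simps(1))
    then show "carrier (quotient_space V U) \<noteq> {\<zero>\<^bsub>quotient_space V U\<^esub>}"
      by (metis singletonD)
    fix X assume X: "subrep G (quotient_space V U) (quotient_action V U \<rho>) X"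
    define U' where "U' = {v \<in> carrier V. U +>\<^bsub>V\<^esub> v \<in> X}"
    have X': "VectorSpace.subspace class_ring X (quotient_space V U)"
      and inv: "\<And>g x. g \<in> carrier G \<Longrightarrow> x \<in> X \<Longrightarrow> quotient_action V U \<rho> g x \<in> X"
      using X by (auto simp: subrep_def)
    note XD = Q.subspaceD[OF X']
    \<comment> \<open>Surjectivity of the projection recovers \<open>X\<close> from its
      preimage.\<close>
    have X_eq: "X = (\<lambda>v. U +>\<^bsub>V\<^esub> v) ` U'"
      using XD(1) by (auto simp: U'_def simps)
    have "VectorSpace.subspace class_ring U' V"
      unfolding subspace_iff
    proof (intro conjI ballI allI)
      show "U' \<subseteq> carrier V"
        by (simp add: U'_def)
      show "\<zero>\<^bsub>V\<^esub> \<in> U'"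
        using XD(2) unfolding U'_def simps(2) by simp
      show "v \<oplus>\<^bsub>V\<^esub> w \<in> U'" if "v \<in> U'" "w \<in> U'" for v w
        using that XD(3)[of "U +>\<^bsub>V\<^esub> v" "U +>\<^bsub>V\<^esub> w"] by (simp add: U'_def simps)
      show "c \<odot>\<^bsub>V\<^esub> v \<in> U'" if "v \<in> U'" for c v
        using that XD(4)[of "U +>\<^bsub>V\<^esub> v" c] by (simp add: U'_def simps)
    qed
    moreover have "\<rho> g v \<in> U'" if "g \<in> carrier G" "v \<in> U'" for g v
      using that inv[of g "U +>\<^bsub>V\<^esub> v"] by (simp add: U'_def simps)
    ultimately have "subrep G V \<rho> U'"
      by (simp add: subrep_def)
    moreover have "U \<subseteq> U'"
    proof
      fix u assume u: "u \<in> U"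
      then have "u \<in> carrier V"
        using subspaceD(1)[OF U] by blast
      then show "u \<in> U'"
        using zero_iff[of u] u XD(2) by (simp add: U'_def)
    qed
    ultimately consider "U' = U" | "U' = carrier V"
      using max by blast
    then show "X = {\<zero>\<^bsub>quotient_space V U\<^esub>} \<or> X = carrier (quotient_space V U)"
    proof cases
      case 1
      have "U +>\<^bsub>V\<^esub> u = \<zero>\<^bsub>quotient_space V U\<^esub>" if "u \<in> U" for u
        using zero_iff[of u] that subspaceD(1)[OF U] by blast
      then have "X \<subseteq> {\<zero>\<^bsub>quotient_space V U\<^esub>}"
        by (simp add: X_eq 1 image_subset_iff)
      then show ?thesis
        using XD(2) by blast
    next
      case 2
      then show ?thesis
        by (simp add: X_eq simps)
    qed
  qed
qed

end

section \<open>Representations generated by reflections\<close>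

text \<open>The determinant is the bridge: both sides say that it is nonzero.\<close>

lemma invertible_mat_iff_trivial_kernel:
  fixes A :: "'a :: field mat"
  assumes A: "A \<in> carrier_mat n n"
  shows "invertible_mat A \<longleftrightarrow> (\<forall>x\<in>carrier_vec n. A *\<^sub>v x = 0\<^sub>v n \<longrightarrow> x = 0\<^sub>v n)"
proof -
  have "invertible_mat A \<longleftrightarrow> det A \<noteq> 0"
  proof
    assume "invertible_mat A"
    then obtain B where AB: "A * B = 1\<^sub>m n" and BA: "B * A = 1\<^sub>m (dim_row B)"
      using A by (auto simp: invertible_mat_def inverts_mat_def)
    \<comment> \<open>The shape of the inverse is not given; comparing column counts in the two
      product equations determines it.\<close>
    have "dim_col B = n" "dim_row B = n"
      using arg_cong[OF AB, of dim_col] arg_cong[OF BA, of dim_col] A by auto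
    then have "B \<in> carrier_mat n n"
      by auto
    then have "det A * det B = 1"
      using det_mult[OF A, of B] AB by simp
    then show "det A \<noteq> 0"
      by auto
  next
    assume "det A \<noteq> 0"
    from det_non_zero_imp_unit[OF A this, of "()"] obtain B
      where "B \<in> carrier_mat n n" "B * A = 1\<^sub>m n" "A * B = 1\<^sub>m n"
      by (auto simp: Units_def ring_mat_def)
    then show "invertible_mat A"
      using A unfolding invertible_mat_def inverts_mat_def by (metis carrier_matD square_mat.simps)
  qed
  then show ?thesis
    using det_0_iff_vec_prod_zero_field[OF A] by blast
qed

text \<open>Collects what the argument uses of the datum. The matrix may be asymmetric, because its
  entries carry the ratios of the numbers \<open>a\<close>, but its zero pattern is symmetric. For
  \<open>i = j\<close> the formula \<open>act_\<alpha>\<close> gives the sign change, as the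
  diagonal entry is 1.\<close>

locale reflection_rep = complex_representation G V \<rho>
  for G :: "('g, 'a) monoid_scheme" and V :: "(complex, 'v, 'b) module_scheme" and \<rho> +
  fixes n :: nat and s :: "nat \<Rightarrow> 'g" and \<alpha> :: "nat \<Rightarrow> 'v" and A :: "complex mat"
  assumes generators: "generate G (s ` {..<n}) = carrier G"
    and involution: "i < n \<Longrightarrow> s i \<otimes>\<^bsub>G\<^esub> s i = \<one>\<^bsub>G\<^esub>"
    and inj_\<alpha>: "inj_on \<alpha> {..<n}"
    and basis_\<alpha>: "basis (\<alpha> ` {..<n})"
    and A_carrier: "A \<in> carrier_mat n n"
    and A_diag: "i < n \<Longrightarrow> A $$ (i, i) = 1"
    and A_zero_sym: "i < n \<Longrightarrow> j < n \<Longrightarrow> A $$ (i, j) = 0 \<Longrightarrow> A $$ (j, i) = 0"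
    and act_\<alpha>: "i < n \<Longrightarrow> j < n \<Longrightarrow> \<rho> (s i) (\<alpha> j) = \<alpha> j \<oplus>\<^bsub>V\<^esub> (- 2 * A $$ (i, j)) \<odot>\<^bsub>V\<^esub> \<alpha> i"
begin

lemma s_carrier [simp]: "i < n \<Longrightarrow> s i \<in> carrier G"
  using generate.incl[of "s i" "s ` {..<n}" G] generators by auto

lemma inv_s: "i < n \<Longrightarrow> inv\<^bsub>G\<^esub> (s i) = s i"
  using group.inv_equality[OF group involution] by simp

lemma \<alpha>_carrier [simp]: "i < n \<Longrightarrow> \<alpha> i \<in> carrier V"
  using basis_\<alpha> by (auto simp: basis_def)

text \<open>Each generator is its own inverse, so the inverse case of \<open>generate\<close> falls
  under the case \<open>gen\<close>.\<close>

lemma generators_induct [consumes 1, case_names one gen mult]: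
  assumes "g \<in> carrier G" "P \<one>\<^bsub>G\<^esub>" "\<And>i. i < n \<Longrightarrow> P (s i)"
    and "\<And>g h. g \<in> carrier G \<Longrightarrow> h \<in> carrier G \<Longrightarrow> P g \<Longrightarrow> P h \<Longrightarrow> P (g \<otimes>\<^bsub>G\<^esub> h)"
  shows "P g"
proof -
  have "g \<in> generate G (s ` {..<n})"
    using assms(1) generators by simp
  then show ?thesis
    by induction (use assms inv_s generators in auto)
qed

lemma subrep_iff:
  "subrep G V \<rho> U \<longleftrightarrow> VectorSpace.subspace class_ring U V \<and> (\<forall>i<n. \<forall>u\<in>U. \<rho> (s i) u \<in> U)"
proof
  assume U: "VectorSpace.subspace class_ring U V \<and> (\<forall>i<n. \<forall>u\<in>U. \<rho> (s i) u \<in> U)"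
  have sub: "U \<subseteq> carrier V"
    using U subspaceD(1) by blast
  have "\<forall>u\<in>U. \<rho> g u \<in> U" if "g \<in> carrier G" for g
    using that
  proof (induction rule: generators_induct)
    case one
    then show ?case
      using sub act_one by auto
  next
    case (gen i)
    then show ?case
      using U by blast
  next
    case (mult g h)
    then show ?case
      using sub act_mult by (metis subsetD)
  qed
  then show "subrep G V \<rho> U"
    using U by (simp add: subrep_def)
qed (auto simp: subrep_def)

section \<open>Coordinates with respect to the basis\<close>

text \<open>The coordinate isomorphism from column vectors to \<open>V\<close>; indexing by numbers
  instead of basis vectors lets \<open>A\<close> act by matrix multiplication.\<close>

definition comb :: "complex vec \<Rightarrow> 'v" where
  "comb x = (\<Oplus>\<^bsub>V\<^esub>j\<in>{..<n}. (x $ j) \<odot>\<^bsub>V\<^esub> \<alpha> j)"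

lemma comb_closed [simp]: "comb x \<in> carrier V"
  unfolding comb_def by (rule M.finsum_closed) auto

lemma comb_add:
  assumes "x \<in> carrier_vec n" "y \<in> carrier_vec n"
  shows "comb (x + y) = comb x \<oplus>\<^bsub>V\<^esub> comb y"
proof -
  have "comb (x + y) = (\<Oplus>\<^bsub>V\<^esub>j\<in>{..<n}. (x $ j) \<odot>\<^bsub>V\<^esub> \<alpha> j \<oplus>\<^bsub>V\<^esub> (y $ j) \<odot>\<^bsub>V\<^esub> \<alpha> j)"
    unfolding comb_def by (rule M.finsum_cong') (use assms smult_class_ring in auto)
  then show ?thesis
    unfolding comb_def by (subst (asm) M.finsum_addf) auto
qed

lemma comb_smult:
  assumes "x \<in> carrier_vec n"
  shows "comb (c \<cdot>\<^sub>v x) = c \<odot>\<^bsub>V\<^esub> comb x"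
proof -
  have "comb (c \<cdot>\<^sub>v x) = (\<Oplus>\<^bsub>V\<^esub>j\<in>{..<n}. c \<odot>\<^bsub>V\<^esub> ((x $ j) \<odot>\<^bsub>V\<^esub> \<alpha> j))"
    unfolding comb_def by (rule M.finsum_cong') (use assms smult_class_ring in auto)
  then show ?thesis
    unfolding comb_def by (subst finsum_smult) auto
qed

lemma comb_zero [simp]: "comb (0\<^sub>v n) = \<zero>\<^bsub>V\<^esub>"
proof -
  have "(0 :: complex) \<cdot>\<^sub>v 0\<^sub>v n = 0\<^sub>v n"
    by auto
  then show ?thesis
    using comb_smult[of "0\<^sub>v n" 0] smult_class_ring(4)[of "comb (0\<^sub>v n)"] by simp
qed

lemma comb_unit:
  assumes "i < n"
  shows "comb (unit_vec n i) = \<alpha> i"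
proof -
  have "comb (unit_vec n i) = (\<Oplus>\<^bsub>V\<^esub>j\<in>{..<n}. if i = j then \<alpha> j else \<zero>\<^bsub>V\<^esub>)"
    unfolding comb_def by (rule M.finsum_cong') (use assms smult_class_ring in auto)
  then show ?thesis
    using M.finsum_singleton[of i "{..<n}" \<alpha>] assms by auto
qed

lemma lincomb_\<alpha>: "lincomb c (\<alpha> ` {..<n}) = comb (vec n (\<lambda>j. c (\<alpha> j)))"
proof -
  have "lincomb c (\<alpha> ` {..<n}) = (\<Oplus>\<^bsub>V\<^esub>j\<in>{..<n}. c (\<alpha> j) \<odot>\<^bsub>V\<^esub> \<alpha> j)"
    unfolding lincomb_def by (rule M.finsum_reindex) (use inj_\<alpha> in auto)
  also have "\<dots> = comb (vec n (\<lambda>j. c (\<alpha> j)))"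
    unfolding comb_def by (rule M.finsum_cong') auto
  finally show ?thesis .
qed

lemma comb_surj:
  assumes "v \<in> carrier V"
  obtains x where "x \<in> carrier_vec n" "v = comb x"
proof -
  have "v \<in> span (\<alpha> ` {..<n})"
    using assms basis_\<alpha> by (simp add: basis_def)
  then obtain c where "v = lincomb c (\<alpha> ` {..<n})"
    using finite_span[of "\<alpha> ` {..<n}"] by (auto simp: image_subset_iff)
  then show ?thesis
    using that[of "vec n (\<lambda>j. c (\<alpha> j))"] by (simp add: lincomb_\<alpha>)
qed

lemma comb_eq_zero:
  assumes "x \<in> carrier_vec n" "comb x = \<zero>\<^bsub>V\<^esub>"
  shows "x = 0\<^sub>v n"
proof -
  \<comment> \<open>Linear independence in the library concerns coefficient functions on vectors, so
    the coordinates are transported along the inverse of \<open>\<alpha>\<close>.\<close>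
  define c where "c v = x $ the_inv_into {..<n} \<alpha> v" for v
  have c: "c (\<alpha> j) = x $ j" if "j < n" for j
    using the_inv_into_f_f[OF inj_\<alpha>, of j] that by (simp add: c_def)
  have "vec n (\<lambda>j. c (\<alpha> j)) = x"
    using assms(1) c by auto
  then have "lincomb c (\<alpha> ` {..<n}) = \<zero>\<^bsub>V\<^esub>"
    using assms(2) by (simp add: lincomb_\<alpha>)
  moreover have "lin_indpt (\<alpha> ` {..<n})"
    using basis_\<alpha> by (simp add: basis_def)
  ultimately have "c \<in> \<alpha> ` {..<n} \<rightarrow> {0}"
    using not_lindepD[of "\<alpha> ` {..<n}" "\<alpha> ` {..<n}" c] by auto
  then have "x $ j = 0" if "j < n" for j
    using c[OF that] that Pi_mem[of c "\<alpha> ` {..<n}" "\<lambda>_. {0}" "\<alpha> j"] by simp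
  then show ?thesis
    using assms(1) by auto
qed

lemma comb_inj: "inj_on comb (carrier_vec n)"
proof (rule inj_onI)
  fix x y assume *: "x \<in> carrier_vec n" "y \<in> carrier_vec n" "comb x = comb y"
  have "comb (x + (-1) \<cdot>\<^sub>v y) = comb y \<oplus>\<^bsub>V\<^esub> \<ominus>\<^bsub>V\<^esub> comb y"
    using * by (simp add: comb_add comb_smult minus_eq_smult)
  then have eq: "x + (-1) \<cdot>\<^sub>v y = 0\<^sub>v n"
    using * by (intro comb_eq_zero) (auto simp: M.r_neg)
  have "x $ j = y $ j" if "j < n" for j
    using arg_cong[OF eq, of "\<lambda>z. z $ j"] that * by simp
  then show "x = y"
    using * by auto
qed

lemma \<alpha>_nonzero: "i < n \<Longrightarrow> \<alpha> i \<noteq> \<zero>\<^bsub>V\<^esub>"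
  using comb_eq_zero[of "unit_vec n i"] by (auto simp: comb_unit)

lemma act_finsum:
  assumes "g \<in> carrier G" "finite J" "\<And>j. j \<in> J \<Longrightarrow> f j \<in> carrier V"
  shows "\<rho> g (\<Oplus>\<^bsub>V\<^esub>j\<in>J. f j) = (\<Oplus>\<^bsub>V\<^esub>j\<in>J. \<rho> g (f j))"
  using assms(2,3)
proof (induction J)
  case empty
  then show ?case
    using act_smult[OF assms(1), of "\<zero>\<^bsub>V\<^esub>" 0] smult_class_ring(4) assms(1) by simp
next
  case (insert j J)
  then show ?case
    using assms(1) by (simp add: act_add Pi_iff)
qed

text \<open>By linearity the basis formulas for \<open>s i\<close>, weighted by the coordinates, add
  up to row \<open>i\<close> of \<open>A\<close> applied to \<open>x\<close>.\<close>

lemma act_comb: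
  assumes i: "i < n" and x: "x \<in> carrier_vec n"
  shows "\<rho> (s i) (comb x) = comb x \<oplus>\<^bsub>V\<^esub> (- 2 * (A *\<^sub>v x) $ i) \<odot>\<^bsub>V\<^esub> \<alpha> i"
proof -
  have "\<rho> (s i) (comb x) = (\<Oplus>\<^bsub>V\<^esub>j\<in>{..<n}. \<rho> (s i) ((x $ j) \<odot>\<^bsub>V\<^esub> \<alpha> j))"
    unfolding comb_def using i by (intro act_finsum) auto
  also have "\<dots> = (\<Oplus>\<^bsub>V\<^esub>j\<in>{..<n}. (x $ j) \<odot>\<^bsub>V\<^esub> \<alpha> j \<oplus>\<^bsub>V\<^esub> (- 2 * (A $$ (i, j) * x $ j)) \<odot>\<^bsub>V\<^esub> \<alpha> i)"
    using i by (intro M.finsum_cong')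
      (auto simp: act_smult act_\<alpha> smult_r_distr smult_class_ring(1)[symmetric] mult_ac)
  also have "\<dots> = comb x \<oplus>\<^bsub>V\<^esub> (\<Oplus>\<^bsub>V\<^esub>j\<in>{..<n}. (- 2 * (A $$ (i, j) * x $ j)) \<odot>\<^bsub>V\<^esub> \<alpha> i)"
    unfolding comb_def using i by (intro M.finsum_addf) auto
  also have "(\<Oplus>\<^bsub>V\<^esub>j\<in>{..<n}. (- 2 * (A $$ (i, j) * x $ j)) \<odot>\<^bsub>V\<^esub> \<alpha> i) =
      (\<Sum>j<n. - 2 * (A $$ (i, j) * x $ j)) \<odot>\<^bsub>V\<^esub> \<alpha> i"
    using i finsum_smult_r[of "\<alpha> i" "\<lambda>j. - 2 * (A $$ (i, j) * x $ j)" "{..<n}"]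
    by (simp add: class_ring_simps)
  also have "(\<Sum>j<n. - 2 * (A $$ (i, j) * x $ j)) = - 2 * (A *\<^sub>v x) $ i"
    using i x A_carrier by (simp add: scalar_prod_def sum_distrib_left lessThan_atLeast0)
  finally show ?thesis .
qed

lemma fin_dim: "fin_dim"
  using basis_\<alpha> unfolding fin_dim_def basis_def by blast

lemma mult_index:
  assumes "i < n" "x \<in> carrier_vec n"
  shows "(A *\<^sub>v x) $ i = (\<Sum>j<n. A $$ (i, j) * x $ j)"
  using assms A_carrier by (simp add: scalar_prod_def lessThan_atLeast0)

lemma act_comb_eq_iff:
  assumes "i < n" "x \<in> carrier_vec n"
  shows "\<rho> (s i) (comb x) = comb x \<longleftrightarrow> (A *\<^sub>v x) $ i = 0"
  using act_comb[OF assms] smult_eq_zero_iff[OF \<alpha>_carrier \<alpha>_nonzero] assms(1) M.show_r_zero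
  by simp

lemma act_\<alpha>_eq_iff:
  assumes "i < n" "j < n"
  shows "\<rho> (s i) (\<alpha> j) = \<alpha> j \<longleftrightarrow> A $$ (i, j) = 0"
proof -
  have "(\<Sum>l<n. A $$ (i, l) * unit_vec n j $ l) = (\<Sum>l<n. if l = j then A $$ (i, j) else 0)"
    using assms(2) by (intro sum.cong) auto
  then have "(A *\<^sub>v unit_vec n j) $ i = A $$ (i, j)"
    using assms by (simp add: mult_index)
  then show ?thesis
    using act_comb_eq_iff[of i "unit_vec n j"] assms by (simp add: comb_unit)
qed

section \<open>The fixed space and the dichotomy for subrepresentations\<close>

text \<open>Fixedness under the generators amounts to fixedness under the whole group, since they
  generate it.\<close>

definition fixed_space :: "'v set" where
  "fixed_space = {v \<in> carrier V. \<forall>i<n. \<rho> (s i) v = v}"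

lemma comb_fixed_iff:
  assumes "x \<in> carrier_vec n"
  shows "comb x \<in> fixed_space \<longleftrightarrow> A *\<^sub>v x = 0\<^sub>v n"
proof -
  have "A *\<^sub>v x = 0\<^sub>v n \<longleftrightarrow> (\<forall>i<n. (A *\<^sub>v x) $ i = 0)"
    using A_carrier by (metis carrier_matD(1) dim_mult_mat_vec eq_vecI index_zero_vec)
  then show ?thesis
    using assms by (simp add: fixed_space_def act_comb_eq_iff)
qed

lemma fixed_space_subspace: "VectorSpace.subspace class_ring fixed_space V"
  using comb_fixed_iff[of "0\<^sub>v n"] A_carrier
  by (auto simp: subspace_iff fixed_space_def act_add act_smult)

lemma subspace_fixed_subrep:
  "VectorSpace.subspace class_ring U V \<Longrightarrow> U \<subseteq> fixed_space \<Longrightarrow> subrep G V \<rho> U"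
  by (auto simp: subrep_iff fixed_space_def)

lemma \<alpha>_not_fixed: "i < n \<Longrightarrow> \<alpha> i \<notin> fixed_space"
  using act_\<alpha>_eq_iff[of i i] A_diag[of i] by (auto simp: fixed_space_def)

lemma fixed_space_trivial_iff: "fixed_space = {\<zero>\<^bsub>V\<^esub>} \<longleftrightarrow> invertible_mat A"
proof
  assume *: "fixed_space = {\<zero>\<^bsub>V\<^esub>}"
  have "x = 0\<^sub>v n" if "x \<in> carrier_vec n" "A *\<^sub>v x = 0\<^sub>v n" for x
    using comb_eq_zero[OF that(1)] comb_fixed_iff[OF that(1)] that(2) * by auto
  then show "invertible_mat A"
    using invertible_mat_iff_trivial_kernel[OF A_carrier] by blast
next
  assume inv: "invertible_mat A"
  have "v = \<zero>\<^bsub>V\<^esub>" if "v \<in> fixed_space" for v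
  proof -
    obtain x where "x \<in> carrier_vec n" "v = comb x"
      using comb_surj \<open>v \<in> fixed_space\<close> by (auto simp: fixed_space_def)
    then show ?thesis
      using that inv invertible_mat_iff_trivial_kernel[OF A_carrier] by (auto simp: comb_fixed_iff)
  qed
  then show "fixed_space = {\<zero>\<^bsub>V\<^esub>}"
    using subspaceD(2)[OF fixed_space_subspace] by blast
qed

text \<open>The reason is that \<open>s\<^sub>i v - v\<close> is a multiple of \<open>\<alpha>\<^sub>i\<close>.\<close>

lemma subrep_dichotomy:
  assumes U: "subrep G V \<rho> U" and v: "v \<in> U" and i: "i < n" and \<alpha>: "\<alpha> i \<notin> U"
  shows "\<rho> (s i) v = v"
proof -
  have sub: "VectorSpace.subspace class_ring U V"
    using U by (simp add: subrep_def)
  obtain x where x: "x \<in> carrier_vec n" "v = comb x"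
    using comb_surj v subspaceD(1)[OF sub] by blast
  have "\<rho> (s i) v \<in> U"
    using U v i by (auto simp: subrep_iff)
  then have "(- 2 * (A *\<^sub>v x) $ i) \<odot>\<^bsub>V\<^esub> \<alpha> i \<in> U"
    using subspace_addD[OF sub v] x i by (simp add: act_comb)
  then have "(A *\<^sub>v x) $ i = 0"
    using subspace_smultD[OF sub \<alpha>_carrier[OF i]] \<alpha> by fastforce
  then show ?thesis
    using act_comb_eq_iff[OF i x(1)] x(2) by simp
qed

text \<open>Otherwise \<open>subrep_dichotomy\<close> would make \<open>s i\<close> fix
  \<open>\<alpha> j\<close>, which forces the entry to vanish.\<close>

lemma subrep_adjacent:
  assumes "subrep G V \<rho> U" "\<alpha> j \<in> U" "i < n" "j < n" "A $$ (i, j) \<noteq> 0"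
  shows "\<alpha> i \<in> U"
  using subrep_dichotomy[OF assms(1,2,3)] act_\<alpha>_eq_iff[OF assms(3,4)] assms(5) by blast

lemma subspace_eq_carrier:
  assumes U: "VectorSpace.subspace class_ring U V" and "\<And>i. i < n \<Longrightarrow> \<alpha> i \<in> U"
  shows "U = carrier V"
proof -
  have "comb x \<in> U" for x
    unfolding comb_def using assms(2) subspaceD(4)[OF U] by (intro subspace_finsum[OF U]) auto
  then show ?thesis
    using subspaceD(1)[OF U] comb_surj by blast
qed

section \<open>Propagation along edges\<close>

text \<open>The graph is read off the nonzero pattern of \<open>A\<close>. Since the diagonal is 1
  it has loops, which do not affect reachability.\<close>

definition adjacency :: "(nat \<times> nat) set" where
  "adjacency = {(i, j). i < n \<and> j < n \<and> A $$ (i, j) \<noteq> 0}"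

lemma sym_adjacency: "sym adjacency"
  using A_zero_sym by (auto simp: adjacency_def sym_def)

lemma subrep_linked:
  assumes "(i, j) \<in> adjacency\<^sup>*" "subrep G V \<rho> U" "\<alpha> i \<in> U"
  shows "\<alpha> j \<in> U"
  using assms(1,3)
proof (induction rule: rtrancl_induct)
  case (step j k)
  \<comment> \<open>The edge is reversed because \<open>subrep_adjacent\<close> moves from the
    column index to the row index.\<close>
  then have "(k, j) \<in> adjacency"
    using sym_adjacency by (auto dest: symD)
  then show ?case
    using subrep_adjacent[OF assms(2), of j k] step by (auto simp: adjacency_def)
qed

lemma fixed_space_ne_carrier: "0 < n \<Longrightarrow> fixed_space \<noteq> carrier V"
  by (metis \<alpha>_not_fixed \<alpha>_carrier)

lemma carrier_nontrivial: "0 < n \<Longrightarrow> carrier V \<noteq> {\<zero>\<^bsub>V\<^esub>}"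
  by (metis \<alpha>_carrier \<alpha>_nonzero singletonD)

section \<open>Connected graphs: indecomposability, irreducibility, the maximal
  subrepresentation\<close>

context
  assumes n_pos: "0 < n" and linked: "\<And>i j. i < n \<Longrightarrow> j < n \<Longrightarrow> (i, j) \<in> adjacency\<^sup>*"
begin

lemma proper_subrep_fixed:
  assumes U: "subrep G V \<rho> U" and "U \<noteq> carrier V"
  shows "U \<subseteq> fixed_space"
proof -
  have sub: "VectorSpace.subspace class_ring U V"
    using U by (simp add: subrep_def)
  have "\<alpha> i \<notin> U" if "i < n" for i
  proof
    assume "\<alpha> i \<in> U"
    then have "\<alpha> j \<in> U" if "j < n" for j
      using subrep_linked[OF linked[OF \<open>i < n\<close> that] U] by simp
    then show False
      using subspace_eq_carrier[OF sub] assms(2) by simp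
  qed
  then show ?thesis
    using subrep_dichotomy[OF U] subspaceD(1)[OF sub] by (auto simp: fixed_space_def)
qed

text \<open>Two summands inside the fixed space cannot add up to \<open>V\<close>. So one of them is
  not contained in it, hence equals \<open>V\<close>, and the other is the zero
  intersection.\<close>

lemma indecomposable: "indecomposable_rep G V \<rho>"
  unfolding indecomposable_rep_def
proof (intro conjI allI impI carrier_nontrivial n_pos)
  show "complex_representation G V \<rho>" ..
  fix U U'
  assume U: "subrep G V \<rho> U" and U': "subrep G V \<rho> U'"
    and int: "U \<inter> U' = {\<zero>\<^bsub>V\<^esub>}" and sum: "U <+>\<^bsub>V\<^esub> U' = carrier V"
  have "U \<subseteq> carrier V" "U' \<subseteq> carrier V"
    using U U' subspaceD(1) by (auto simp: subrep_def)
  moreover have "\<not> (U \<subseteq> fixed_space \<and> U' \<subseteq> fixed_space)"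
  proof
    assume "U \<subseteq> fixed_space \<and> U' \<subseteq> fixed_space"
    then have "U <+>\<^bsub>V\<^esub> U' \<subseteq> fixed_space"
      using subspaceD(3)[OF fixed_space_subspace] by (auto simp: set_add_def' subset_iff)
    then show False
      using sum fixed_space_ne_carrier[OF n_pos] by (auto simp: fixed_space_def)
  qed
  ultimately show "U = {\<zero>\<^bsub>V\<^esub>} \<or> U' = {\<zero>\<^bsub>V\<^esub>}"
    using int proper_subrep_fixed[OF U] proper_subrep_fixed[OF U'] by blast
qed

text \<open>The fixed space is a proper subrepresentation and contains all others, so irreducibility
  means that it vanishes.\<close>

lemma irreducible_iff: "irreducible_rep G V \<rho> \<longleftrightarrow> invertible_mat A"
proof -
  have "irreducible_rep G V \<rho> \<longleftrightarrow> fixed_space = {\<zero>\<^bsub>V\<^esub>}"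
  proof
    assume "irreducible_rep G V \<rho>"
    then show "fixed_space = {\<zero>\<^bsub>V\<^esub>}"
      using subspace_fixed_subrep[OF fixed_space_subspace] fixed_space_ne_carrier[OF n_pos]
      by (auto simp: irreducible_rep_def)
  next
    assume fixed: "fixed_space = {\<zero>\<^bsub>V\<^esub>}"
    have "U = {\<zero>\<^bsub>V\<^esub>} \<or> U = carrier V" if U: "subrep G V \<rho> U" for U
      using proper_subrep_fixed[OF U] fixed U subspaceD(2)[of U] by (auto simp: subrep_def)
    then show "irreducible_rep G V \<rho>"
      using complex_representation_axioms carrier_nontrivial[OF n_pos] by (auto simp: irreducible_rep_def)
  qed
  then show ?thesis
    using fixed_space_trivial_iff by simp
qed

lemma maximal_subrep_eq:
  assumes max: "maximal_subrep G V \<rho> U"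
  shows "U = fixed_space"
proof -
  have "U \<subseteq> fixed_space"
    using max proper_subrep_fixed by (simp add: maximal_subrep_def)
  moreover have "subrep G V \<rho> fixed_space"
    by (rule subspace_fixed_subrep[OF fixed_space_subspace order_refl])
  ultimately have "fixed_space = U"
    using max fixed_space_ne_carrier[OF n_pos] unfolding maximal_subrep_def by blast
  then show ?thesis
    by simp
qed

end

section \<open>The rank of the matrix as a dimension\<close>

text \<open>In coordinates \<open>A\<close> is a linear map on \<open>V\<close> with kernel the
  fixed space and image the column space. Rank-nullity for it and for the projection share the
  kernel and the total dimension, so image and quotient have equal dimension.\<close>

lemma dim_quotient_fixed_space:
  "vectorspace.dim class_ring (quotient_space V fixed_space) = vec_space.rank n A"
proof -
  interpret vec: vec_space "TYPE(complex)" n .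
  \<comment> \<open>This inverse of \<open>comb\<close> is meaningful exactly on the carrier of
    \<open>V\<close>, which is the image of \<open>comb\<close>.\<close>
  define coord where "coord = the_inv_into (carrier_vec n) comb"
  define \<Phi> where "\<Phi> v = A *\<^sub>v coord v" for v
  have \<Phi>_comb: "\<Phi> (comb x) = A *\<^sub>v x" if "x \<in> carrier_vec n" for x
    using the_inv_into_f_f[OF comb_inj that] by (simp add: \<Phi>_def coord_def)
  have hom: "\<Phi> \<in> LinearCombinations.module_hom class_ring V (module_vec TYPE(complex) n)"
    unfolding LinearCombinations.module_hom_def
  proof (intro CollectI conjI allI impI Pi_I; (elim conjE)?)
    fix v assume "v \<in> carrier V"
    then obtain x where "x \<in> carrier_vec n" "v = comb x"
      using comb_surj by blast
    then show "\<Phi> v \<in> carrier (module_vec TYPE(complex) n)"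
      using A_carrier by (simp add: \<Phi>_comb module_vec_simps)
  next
    fix v w assume "v \<in> carrier V" "w \<in> carrier V"
    then obtain x y where "x \<in> carrier_vec n" "v = comb x" "y \<in> carrier_vec n" "w = comb y"
      using comb_surj by metis
    then show "\<Phi> (v \<oplus>\<^bsub>V\<^esub> w) = \<Phi> v \<oplus>\<^bsub>module_vec TYPE(complex) n\<^esub> \<Phi> w"
      using A_carrier by (simp add: comb_add[symmetric] \<Phi>_comb module_vec_simps mult_add_distrib_mat_vec)
  next
    fix c :: complex and v assume "v \<in> carrier V"
    then obtain x where "x \<in> carrier_vec n" "v = comb x"
      using comb_surj by blast
    then show "\<Phi> (c \<odot>\<^bsub>V\<^esub> v) = c \<odot>\<^bsub>module_vec TYPE(complex) n\<^esub> \<Phi> v"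
      using A_carrier by (simp add: comb_smult[symmetric] \<Phi>_comb module_vec_simps mult_mat_vec)
  qed
  interpret \<Phi>: linear_map class_ring V "module_vec TYPE(complex) n" \<Phi>
    using hom vectorspace vec.vectorspace_axioms
    by (simp add: linear_map_def mod_hom_def mod_hom_axioms_def vectorspace_def)
  have "\<Phi>.ker = fixed_space"
  proof (intro equalityI subsetI)
    fix v assume "v \<in> \<Phi>.ker"
    then obtain x where "x \<in> carrier_vec n" "v = comb x" "\<Phi> v = 0\<^sub>v n"
      using comb_surj by (auto simp: \<Phi>.ker_def module_vec_simps)
    then show "v \<in> fixed_space"
      by (simp add: \<Phi>_comb comb_fixed_iff)
  next
    fix v assume v: "v \<in> fixed_space"
    then obtain x where "x \<in> carrier_vec n" "v = comb x"
      using comb_surj by (auto simp: fixed_space_def)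
    then show "v \<in> \<Phi>.ker"
      using v by (simp add: \<Phi>_comb comb_fixed_iff \<Phi>.ker_def module_vec_simps)
  qed
  moreover have "\<Phi>.im = vec.span (set (cols A))"
  proof -
    have "\<Phi>.im = {y \<in> carrier_vec n. \<exists>x\<in>carrier_vec n. A *\<^sub>v x = y}"
    proof (intro equalityI subsetI)
      fix y assume "y \<in> \<Phi>.im"
      then obtain v where v: "v \<in> carrier V" "y = \<Phi> v"
        by (auto simp: \<Phi>.im_def)
      then obtain x where "x \<in> carrier_vec n" "v = comb x"
        using comb_surj by blast
      then show "y \<in> {y \<in> carrier_vec n. \<exists>x\<in>carrier_vec n. A *\<^sub>v x = y}"
        using v A_carrier by (auto simp: \<Phi>_comb)
    next
      fix y assume "y \<in> {y \<in> carrier_vec n. \<exists>x\<in>carrier_vec n. A *\<^sub>v x = y}"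
      then obtain x where "x \<in> carrier_vec n" "y = \<Phi> (comb x)"
        by (auto simp: \<Phi>_comb)
      then show "y \<in> \<Phi>.im"
        by (auto simp: \<Phi>.im_def)
    qed
    then show ?thesis
      using vec.col_space_eq[OF A_carrier] A_carrier by (simp add: vec.col_space_def)
  qed
  ultimately show ?thesis
    using \<Phi>.rank_nullity[OF fin_dim] dim_quotient[OF fin_dim fixed_space_subspace]
    by (simp add: vec.rank_def)
qed

section \<open>Coordinate subspaces\<close>

text \<open>The span of the basis vectors with index in \<open>I\<close>, described by supports so
  that intersections can be read off. Elements of \<open>I\<close> outside the index range have no
  effect, which allows plain complements \<open>- I\<close>.\<close>

definition coord_space :: "nat set \<Rightarrow> 'v set" where
  "coord_space I = comb ` {x \<in> carrier_vec n. \<forall>j<n. j \<notin> I \<longrightarrow> x $ j = 0}"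

lemma coord_space_mono: "I \<subseteq> J \<Longrightarrow> coord_space I \<subseteq> coord_space J"
  unfolding coord_space_def by (intro image_mono) auto

lemma coord_space_subspace: "VectorSpace.subspace class_ring (coord_space I) V"
  unfolding subspace_iff
proof (intro conjI ballI allI)
  show "coord_space I \<subseteq> carrier V"
    by (auto simp: coord_space_def)
  show "\<zero>\<^bsub>V\<^esub> \<in> coord_space I"
    unfolding coord_space_def by (rule image_eqI[of _ _ "0\<^sub>v n"]) auto
next
  fix v w assume "v \<in> coord_space I" "w \<in> coord_space I"
  then obtain x y where "x \<in> carrier_vec n" "\<forall>j<n. j \<notin> I \<longrightarrow> x $ j = 0" "v = comb x"
    "y \<in> carrier_vec n" "\<forall>j<n. j \<notin> I \<longrightarrow> y $ j = 0" "w = comb y"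
    by (auto simp: coord_space_def)
  then show "v \<oplus>\<^bsub>V\<^esub> w \<in> coord_space I"
    unfolding coord_space_def by (intro image_eqI[of _ _ "x + y"]) (auto simp: comb_add)
next
  fix c v assume "v \<in> coord_space I"
  then obtain x where "x \<in> carrier_vec n" "\<forall>j<n. j \<notin> I \<longrightarrow> x $ j = 0" "v = comb x"
    by (auto simp: coord_space_def)
  then show "c \<odot>\<^bsub>V\<^esub> v \<in> coord_space I"
    unfolding coord_space_def by (intro image_eqI[of _ _ "c \<cdot>\<^sub>v x"]) (auto simp: comb_smult)
qed

lemma \<alpha>_in_coord_space_iff:
  assumes "i < n"
  shows "\<alpha> i \<in> coord_space I \<longleftrightarrow> i \<in> I"
proof
  assume "\<alpha> i \<in> coord_space I"
  then obtain x where x: "x \<in> carrier_vec n" "\<forall>j<n. j \<notin> I \<longrightarrow> x $ j = 0" "comb (unit_vec n i) = comb x"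
    using assms by (auto simp: coord_space_def comb_unit)
  then have "unit_vec n i = x"
    using comb_inj by (auto dest: inj_onD)
  then have "x $ i = 1"
    using assms by auto
  then show "i \<in> I"
    using x(2) assms by fastforce
next
  assume "i \<in> I"
  then show "\<alpha> i \<in> coord_space I"
    unfolding coord_space_def using assms
    by (intro image_eqI[of _ _ "unit_vec n i"]) (auto simp: comb_unit)
qed

lemma coord_space_disjoint:
  assumes "I \<inter> J = {}"
  shows "coord_space I \<inter> coord_space J = {\<zero>\<^bsub>V\<^esub>}"
proof (intro equalityI subsetI)
  fix v assume "v \<in> coord_space I \<inter> coord_space J"
  then obtain x y where x: "x \<in> carrier_vec n" "\<forall>j<n. j \<notin> I \<longrightarrow> x $ j = 0" "v = comb x"
    and y: "y \<in> carrier_vec n" "\<forall>j<n. j \<notin> J \<longrightarrow> y $ j = 0" "v = comb y"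
    by (auto simp: coord_space_def)
  have "x = y"
    using x y comb_inj by (auto dest: inj_onD)
  then have "x = 0\<^sub>v n"
    using x y assms by (intro eq_vecI) auto
  then show "v \<in> {\<zero>\<^bsub>V\<^esub>}"
    using x by simp
qed (use subspaceD(2)[OF coord_space_subspace] in auto)

lemma coord_space_least:
  assumes U: "VectorSpace.subspace class_ring U V" and "\<And>i. i < n \<Longrightarrow> i \<in> I \<Longrightarrow> \<alpha> i \<in> U"
  shows "coord_space I \<subseteq> U"
proof
  fix v assume "v \<in> coord_space I"
  then obtain x where x: "\<forall>j<n. j \<notin> I \<longrightarrow> x $ j = 0" "v = comb x"
    by (auto simp: coord_space_def)
  have "(x $ j) \<odot>\<^bsub>V\<^esub> \<alpha> j \<in> U" if "j < n" for j
  proof (cases "j \<in> I")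
    case True
    then show ?thesis
      using assms(2)[OF that] subspaceD(4)[OF U] by simp
  next
    case False
    then show ?thesis
      using x(1) that subspaceD(2)[OF U] by (simp add: smult_class_ring(4))
  qed
  then show "v \<in> U"
    unfolding x(2) comb_def by (intro subspace_finsum[OF U]) auto
qed

text \<open>For \<open>i\<close> in \<open>I\<close> the generator adds a multiple of
  \<open>\<alpha> i\<close>, which lies in the space. For \<open>i\<close> outside \<open>I\<close>,
  row \<open>i\<close> of \<open>A\<close> vanishes at the columns in \<open>I\<close>, by
  closedness and the symmetric zero pattern, so \<open>s i\<close> fixes the vector.\<close>

lemma coord_space_subrep:
  assumes closed: "\<And>i j. j \<in> I \<Longrightarrow> (j, i) \<in> adjacency \<Longrightarrow> i \<in> I"
  shows "subrep G V \<rho> (coord_space I)"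
  unfolding subrep_iff
proof (intro conjI coord_space_subspace allI impI ballI)
  fix i v assume i: "i < n" and v: "v \<in> coord_space I"
  then obtain x where x: "x \<in> carrier_vec n" "\<forall>j<n. j \<notin> I \<longrightarrow> x $ j = 0" "v = comb x"
    by (auto simp: coord_space_def)
  show "\<rho> (s i) v \<in> coord_space I"
  proof (cases "i \<in> I")
    case True
    then have "\<alpha> i \<in> coord_space I"
      using \<alpha>_in_coord_space_iff[OF i] by simp
    then show ?thesis
      using v x(3) subspaceD(3,4)[OF coord_space_subspace] by (simp add: act_comb[OF i x(1)])
  next
    case False
    have "A $$ (i, j) * x $ j = 0" if "j < n" for j
    proof (cases "j \<in> I")
      case True
      then have "A $$ (j, i) = 0"
        using closed[OF True, of i] False i that by (auto simp: adjacency_def)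
      then show ?thesis
        using A_zero_sym[OF that i] by simp
    qed (use x(2) that in simp)
    then have "(A *\<^sub>v x) $ i = 0"
      unfolding mult_index[OF i x(1)] by (intro sum.neutral) blast
    then show ?thesis
      using act_comb_eq_iff[OF i x(1)] v x(3) by simp
  qed
qed

section \<open>Cutting vectors along the index set of a subrepresentation\<close>

definition cut :: "nat set \<Rightarrow> complex vec \<Rightarrow> complex vec" where
  "cut I x = vec n (\<lambda>j. if j \<in> I then x $ j else 0)"

lemma cut_carrier [simp]: "cut I x \<in> carrier_vec n"
  by (simp add: cut_def)

lemma comb_cut_in: "comb (cut I x) \<in> coord_space I"
  unfolding coord_space_def by (rule imageI) (simp add: cut_def)

lemma comb_cut_add:
  assumes "x \<in> carrier_vec n"
  shows "comb x = comb (cut I x) \<oplus>\<^bsub>V\<^esub> comb (cut (- I) x)"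
proof -
  have "x = cut I x + cut (- I) x"
    using assms by (intro eq_vecI) (auto simp: cut_def)
  then show ?thesis
    by (metis comb_add cut_carrier)
qed

lemma mult_cut:
  assumes "i < n"
  shows "(A *\<^sub>v cut I x) $ i = (\<Sum>j<n. if j \<in> I then A $$ (i, j) * x $ j else 0)"
  unfolding mult_index[OF assms cut_carrier] by (rule sum.cong) (auto simp: cut_def)

text \<open>For a subrepresentation \<open>U\<close>, the matrix \<open>A\<close> has no nonzero entries between the set of
  indices \<open>i\<close> with \<open>\<alpha>\<^sub>i \<in> U\<close> and its complement, so cutting along this set commutes with \<open>A\<close>.\<close>

lemma mult_cut_subrep:
  assumes U: "subrep G V \<rho> U" and x: "x \<in> carrier_vec n" and i: "i < n"
  defines "I \<equiv> {i. i < n \<and> \<alpha> i \<in> U}"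
  shows "(A *\<^sub>v cut I x) $ i = (if i \<in> I then (A *\<^sub>v x) $ i else 0)"
    and "(A *\<^sub>v cut (- I) x) $ i = (if i \<in> I then 0 else (A *\<^sub>v x) $ i)"
proof -
  \<comment> \<open>\<open>subrep_adjacent\<close> handles the entries with column index in
    \<open>I\<close>; the others follow by the symmetric zero pattern.\<close>
  have off: "A $$ (i, j) = 0" if "j < n" "(i \<in> I) \<noteq> (j \<in> I)" for j
  proof (cases "i \<in> I")
    case True
    then have "A $$ (j, i) = 0"
      using subrep_adjacent[OF U _ that(1) i] that by (auto simp: I_def)
    then show ?thesis
      by (rule A_zero_sym[OF that(1) i])
  next
    case False
    then show ?thesis
      using subrep_adjacent[OF U _ i that(1)] that i by (auto simp: I_def)
  qed
  show "(A *\<^sub>v cut I x) $ i = (if i \<in> I then (A *\<^sub>v x) $ i else 0)"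
    unfolding mult_cut[OF i] mult_index[OF i x]
    by (cases "i \<in> I") (auto simp: off intro!: sum.cong sum.neutral)
  show "(A *\<^sub>v cut (- I) x) $ i = (if i \<in> I then 0 else (A *\<^sub>v x) $ i)"
    unfolding mult_cut[OF i] mult_index[OF i x]
    by (cases "i \<in> I") (auto simp: off intro!: sum.cong sum.neutral)
qed

text \<open>Split a vector of \<open>U\<close> along \<open>I\<close>. The part outside
  \<open>I\<close> is killed by every row of \<open>A\<close>: by rows in \<open>I\<close> because
  the blocks decouple, by the others because of \<open>subrep_dichotomy\<close>. Invertibility then
  makes this part zero.\<close>

lemma subrep_eq_coord_space:
  assumes inv: "invertible_mat A" and U: "subrep G V \<rho> U"
  shows "U = coord_space {i. i < n \<and> \<alpha> i \<in> U}"
proof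
  have sub: "VectorSpace.subspace class_ring U V"
    using U by (simp add: subrep_def)
  define I where "I = {i. i < n \<and> \<alpha> i \<in> U}"
  have ge: "coord_space I \<subseteq> U"
    by (rule coord_space_least[OF sub]) (simp add: I_def)
  then show "coord_space {i. i < n \<and> \<alpha> i \<in> U} \<subseteq> U"
    by (simp add: I_def)
  show "U \<subseteq> coord_space {i. i < n \<and> \<alpha> i \<in> U}"
  proof
    fix v assume v: "v \<in> U"
    then obtain x where x: "x \<in> carrier_vec n" "v = comb x"
      using comb_surj subspaceD(1)[OF sub] by blast
    have "(A *\<^sub>v cut (- I) x) $ i = 0" if "i < n" for i
    proof (cases "i \<in> I")
      case False
      then have "\<rho> (s i) v = v"
        using subrep_dichotomy[OF U v that] that by (simp add: I_def)
      then show ?thesis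
        using mult_cut_subrep(2)[OF U x(1) that] act_comb_eq_iff[OF that x(1)] x(2) by (simp add: I_def)
    qed (use mult_cut_subrep(2)[OF U x(1) that] in \<open>simp add: I_def\<close>)
    then have "A *\<^sub>v cut (- I) x = 0\<^sub>v n"
      using A_carrier by (intro eq_vecI) auto
    then have "cut (- I) x = 0\<^sub>v n"
      using inv invertible_mat_iff_trivial_kernel[OF A_carrier] by simp
    then have "v = comb (cut I x)"
      using comb_cut_add[OF x(1), of I] x(2) by simp
    then show "v \<in> coord_space {i. i < n \<and> \<alpha> i \<in> U}"
      using comb_cut_in[of I x] by (simp add: I_def)
  qed
qed

section \<open>Semisimplicity\<close>

text \<open>The summands are the coordinate spaces of the connected components. A subrepresentation
  of such a summand either contains one of its basis vectors, hence by linking all of them, or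
  contains none and is zero.\<close>

lemma semisimple_if_invertible:
  assumes inv: "invertible_mat A"
  shows "semisimple_rep G V \<rho>"
proof -
  define C where "C i = {j. (i, j) \<in> adjacency\<^sup>*}" for i
  \<comment> \<open>Indices in the same component give the same space, so as a set the family lists
    each component once.\<close>
  define \<U> where "\<U> = (\<lambda>i. coord_space (C i)) ` {..<n}"
  have C_eq: "C i = C j" if "(i, j) \<in> adjacency\<^sup>*" for i j
    using that symD[OF sym_rtrancl[OF sym_adjacency] that] by (auto simp: C_def)
  have C_disj: "C j \<subseteq> - C i" if "C i \<noteq> C j" for i j
  proof
    fix x assume "x \<in> C j"
    then show "x \<in> - C i"
      using C_eq[of i x] C_eq[of j x] that by (auto simp: C_def)
  qed
  have subrep: "subrep G V \<rho> (coord_space (C i))" for i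
    by (rule coord_space_subrep) (auto simp: C_def)
  have \<alpha>_in: "\<alpha> i \<in> coord_space (C i)" if "i < n" for i
    using \<alpha>_in_coord_space_iff[OF that] by (simp add: C_def)
  have irr: "irreducible_rep G (V\<lparr>carrier := coord_space (C i)\<rparr>) \<rho>" if i: "i < n" for i
    unfolding irreducible_restrict_iff[OF subrep]
  proof (intro conjI allI impI)
    show "coord_space (C i) \<noteq> {\<zero>\<^bsub>V\<^esub>}"
      using \<alpha>_in[OF i] \<alpha>_nonzero[OF i] by auto
    fix U assume U: "subrep G V \<rho> U" and le: "U \<subseteq> coord_space (C i)"
    have sub: "VectorSpace.subspace class_ring U V"
      using U by (simp add: subrep_def)
    show "U = {\<zero>\<^bsub>V\<^esub>} \<or> U = coord_space (C i)"
    proof (cases "\<exists>j<n. \<alpha> j \<in> U")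
      case True
      then obtain j where j: "j < n" "\<alpha> j \<in> U"
        by blast
      then have "(i, j) \<in> adjacency\<^sup>*"
        using le \<alpha>_in_coord_space_iff[OF j(1)] by (auto simp: C_def)
      then have "C i = C j"
        by (rule C_eq)
      then have "\<alpha> l \<in> U" if "l \<in> C i" for l
        using subrep_linked[OF _ U j(2)] that by (simp add: C_def)
      then show ?thesis
        using coord_space_least[OF sub] le by blast
    next
      case False
      then have empty: "{i. i < n \<and> \<alpha> i \<in> U} = {}"
        by blast
      have "U = coord_space {}"
        by (rule subrep_eq_coord_space[OF inv U, unfolded empty])
      \<comment> \<open>With both index sets empty, disjointness says that
        \<open>coord_space {}\<close> is zero.\<close>
      then show ?thesis
        using coord_space_disjoint[of "{}" "{}"] by simp
    qed
  qed
  have carr: "\<Union>\<U>' \<subseteq> carrier V" if "\<U>' \<subseteq> \<U>" for \<U>'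
    using that subspaceD(1)[OF coord_space_subspace] by (force simp: \<U>_def)
  have "\<alpha> i \<in> span (\<Union>\<U>)" if "i < n" for i
    using \<alpha>_in[OF that] that span_mem[OF carr[OF order_refl]] by (auto simp: \<U>_def)
  then have span: "span (\<Union>\<U>) = carrier V"
    by (intro subspace_eq_carrier span_is_subspace carr) auto
  have indep: "U \<inter> span (\<Union>(\<U> - {U})) = {\<zero>\<^bsub>V\<^esub>}" if "U \<in> \<U>" for U
  proof -
    obtain i where i: "i < n" "U = coord_space (C i)"
      using \<open>U \<in> \<U>\<close> by (auto simp: \<U>_def)
    have "U' \<subseteq> coord_space (- C i)" if U': "U' \<in> \<U> - {U}" for U'
    proof -
      obtain j where j: "U' = coord_space (C j)" "U' \<noteq> U"
        using U' by (auto simp: \<U>_def)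
      then have "C i \<noteq> C j"
        using i(2) by auto
      then show ?thesis
        unfolding j(1) by (rule coord_space_mono[OF C_disj])
    qed
    \<comment> \<open>All other summands live on the complement of the component, so their span
      meets \<open>U\<close> only in zero.\<close>
    then have "span (\<Union>(\<U> - {U})) \<subseteq> coord_space (- C i)"
      using is_module[OF coord_space_subspace] by (intro span_is_subset) auto
    then have "U \<inter> span (\<Union>(\<U> - {U})) \<subseteq> {\<zero>\<^bsub>V\<^esub>}"
      using coord_space_disjoint[of "C i" "- C i"] i(2) by auto
    then show ?thesis
      using subspaceD(2)[OF coord_space_subspace] i(2) span_zero by auto
  qed
  show ?thesis
    unfolding semisimple_rep_def
    using complex_representation_axioms subrep irr span indep
    by (intro conjI exI[of _ \<U>] ballI) (auto simp: \<U>_def)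
qed

text \<open>Some irreducible summand contains a given \<open>\<alpha>\<^sub>j\<close>, and cutting a kernel vector \<open>x\<close> with
  \<open>x\<^sub>j \<noteq> 0\<close> along that summand gives a nonzero fixed vector in it.\<close>

lemma invertible_if_semisimple:
  assumes "semisimple_rep G V \<rho>"
  shows "invertible_mat A"
proof (rule ccontr)
  assume "\<not> invertible_mat A"
  then obtain x where x: "x \<in> carrier_vec n" "A *\<^sub>v x = 0\<^sub>v n" "x \<noteq> 0\<^sub>v n"
    using invertible_mat_iff_trivial_kernel[OF A_carrier] by blast
  obtain j where j: "j < n" "x $ j \<noteq> 0"
    using x(1,3) by (metis carrier_vecD eq_vecI index_zero_vec)
  obtain \<U> where sub: "\<And>U. U \<in> \<U> \<Longrightarrow> subrep G V \<rho> U"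
    and irr: "\<And>U. U \<in> \<U> \<Longrightarrow> irreducible_rep G (V\<lparr>carrier := U\<rparr>) \<rho>"
    and span: "span (\<Union>\<U>) = carrier V"
    using assms by (auto simp: semisimple_rep_def)
  have "\<exists>U\<in>\<U>. \<alpha> j \<in> U"
  proof (rule ccontr)
    assume *: "\<not> (\<exists>U\<in>\<U>. \<alpha> j \<in> U)"
    \<comment> \<open>If no summand contained \<open>\<alpha> j\<close>, then \<open>s j\<close>
      would fix every summand pointwise, hence all of \<open>V\<close>, although it negates
      \<open>\<alpha> j\<close>.\<close>
    have "VectorSpace.subspace class_ring {v \<in> carrier V. \<rho> (s j) v = v} V"
      using act_smult[of "s j" "\<zero>\<^bsub>V\<^esub>" 0] j(1)
      by (auto simp: subspace_iff act_add act_smult smult_class_ring(4))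
    moreover have "U \<subseteq> {v \<in> carrier V. \<rho> (s j) v = v}" if "U \<in> \<U>" for U
      using subrep_dichotomy[OF sub[OF that] _ j(1)] * that subspaceD(1)[of U] sub[OF that]
      by (auto simp: subrep_def)
    ultimately have "span (\<Union>\<U>) \<subseteq> {v \<in> carrier V. \<rho> (s j) v = v}"
      using is_module by (intro span_is_subset) auto
    then have "\<rho> (s j) (\<alpha> j) = \<alpha> j"
      using span \<alpha>_carrier[OF j(1)] by blast
    then show False
      using act_\<alpha>_eq_iff[OF j(1) j(1)] A_diag[OF j(1)] by simp
  qed
  then obtain U where U: "U \<in> \<U>" "\<alpha> j \<in> U"
    by blast
  have subU: "VectorSpace.subspace class_ring U V"
    using sub[OF U(1)] by (simp add: subrep_def)
  define I where "I = {i. i < n \<and> \<alpha> i \<in> U}"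
  define y where "y = cut I x"
  have y: "y \<in> carrier_vec n"
    by (simp add: y_def)
  have "(A *\<^sub>v y) $ i = 0" if "i < n" for i
    using mult_cut_subrep(1)[OF sub[OF U(1)] x(1) that] x(2) that by (simp add: y_def I_def)
  then have "A *\<^sub>v y = 0\<^sub>v n"
    using A_carrier by (intro eq_vecI) auto
  then have "comb y \<in> fixed_space"
    by (simp add: comb_fixed_iff[OF y])
  moreover have "comb y \<in> U"
    using coord_space_least[OF subU, of I] comb_cut_in[of I x] by (auto simp: y_def I_def)
  moreover have "y $ j \<noteq> 0"
    using j U(2) by (simp add: y_def cut_def I_def)
  then have "comb y \<noteq> \<zero>\<^bsub>V\<^esub>"
    using comb_eq_zero[OF y] j(1) by auto
  \<comment> \<open>This subrepresentation of the irreducible \<open>U\<close> contains the nonzero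
    \<open>comb y\<close>, so it is all of \<open>U\<close>; but \<open>\<alpha> j\<close> lies in
    \<open>U\<close> and is not fixed.\<close>
  moreover have "subrep G V \<rho> (U \<inter> fixed_space)"
    by (intro subspace_fixed_subrep subspace_inter subU fixed_space_subspace) auto
  ultimately have "U \<inter> fixed_space = U"
    using irr[OF U(1)] unfolding irreducible_restrict_iff[OF sub[OF U(1)]] by blast
  then show False
    using \<alpha>_not_fixed[OF j(1)] U(2) by blast
qed

end

section \<open>IR-representations\<close>

text \<open>The word of length two is a relator, and congruent words have equal values in the
  presented group.\<close>

lemma coxeter_generator_squared:
  assumes "coxeter_system W n s m" "i < n"
  shows "s i \<otimes>\<^bsub>W\<^esub> s i = \<one>\<^bsub>W\<^esub>"
proof -
  have pres: "has_presentation W {..<n} (coxeter_relators n m) s"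
    using assms(1) by (simp add: coxeter_system_def)
  interpret group W
    using pres by (simp add: has_presentation_def)
  have faithful: "word_value W s w = word_value W s w' \<longleftrightarrow> pres_cong {..<n} (coxeter_relators n m) w w'"
    if "set w \<subseteq> {..<n} \<times> UNIV" "set w' \<subseteq> {..<n} \<times> UNIV" for w w'
    using pres that by (simp add: has_presentation_def)
  have "[(i, True), (i, True)] \<in> coxeter_relators n m"
    using assms(2) by (auto simp: coxeter_relators_def)
  then have "pres_cong {..<n} (coxeter_relators n m) [(i, True), (i, True)] []"
    using pres_cong.relator[of "[(i, True), (i, True)]" _ _ "[]" "[]"] by simp
  then have "word_value W s [(i, True), (i, True)] = word_value W s []"
    using faithful[of "[(i, True), (i, True)]" "[]"] assms(2) by simp
  moreover have "s i \<in> carrier W"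
    using pres assms(2) by (auto simp: has_presentation_def)
  ultimately show ?thesis
    by simp
qed

text \<open>Both ratios of the numbers \<open>a\<close> are nonzero, so off the diagonal vanishing
  is decided by the cosine, which is symmetric in the two indices.\<close>

lemma ir_matrix_zero_sym:
  assumes "coxeter_system W n s m" "ir_datum n m k a" "i < n" "j < n"
    and "ir_matrix n m k a $$ (i, j) = 0"
  shows "ir_matrix n m k a $$ (j, i) = 0"
  using assms by (auto simp: ir_matrix_def ir_datum_def coxeter_system_def)

text \<open>If \<open>m i j\<close> were twice \<open>k i j\<close>, the gcd would be
  \<open>k i j\<close> and the quotient 2, excluding an edge. Hence the angle lies strictly between
  0 and a right angle.\<close>

lemma ir_matrix_edge_nonzero:
  assumes datum: "ir_datum n m k a" and ij: "i < n" "j < n" "i \<noteq> j"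
    and edge: "3 \<le> m i j div gcd (m i j) (k i j)"
  shows "ir_matrix n m k a $$ (i, j) \<noteq> 0"
proof -
  have k: "1 \<le> k i j" "real (k i j) \<le> real (m i j) / 2" and a: "a i j \<noteq> 0" "a j i \<noteq> 0"
    using datum ij by (auto simp: ir_datum_def)
  have "m i j \<noteq> 2 * k i j"
    using edge k(1) by auto
  then have less: "real (k i j) < real (m i j) / 2"
    using k(2) by linarith
  then have "real (k i j) * pi / real (m i j) < pi / 2"
    using k(1) by (simp add: field_simps)
  moreover have "0 < real (k i j) * pi / real (m i j)"
    using k(1) less by simp
  ultimately have "cos (real (k i j) * pi / real (m i j)) > 0"
    by (intro cos_gt_zero)
  then show ?thesis
    using a ij by (simp add: ir_matrix_def)
qed

lemma ir_reflection_rep: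
  assumes cox: "coxeter_system W n s m" and datum: "ir_datum n m k a"
    and ir: "ir_representation W n s V \<rho> \<alpha>" and def: "ir_defined_by n s m V \<rho> \<alpha> k a"
  shows "reflection_rep W V \<rho> n s \<alpha> (ir_matrix n m k a)"
proof -
  interpret complex_representation W V \<rho>
    using ir by (simp add: ir_representation_def)
  show ?thesis
  proof
    show basis: "basis (\<alpha> ` {..<n})" and "inj_on \<alpha> {..<n}"
      using ir by (simp_all add: ir_representation_def)
    show "generate W (s ` {..<n}) = carrier W"
      using cox by (simp add: coxeter_system_def has_presentation_def)
    show "ir_matrix n m k a \<in> carrier_mat n n"
      by (simp add: ir_matrix_def)
    show "s i \<otimes>\<^bsub>W\<^esub> s i = \<one>\<^bsub>W\<^esub>" if "i < n" for i
      by (rule coxeter_generator_squared[OF cox that])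
    show "ir_matrix n m k a $$ (i, i) = 1" if "i < n" for i
      using that by (simp add: ir_matrix_def)
    show "ir_matrix n m k a $$ (j, i) = 0" if "i < n" "j < n" "ir_matrix n m k a $$ (i, j) = 0" for i j
      by (rule ir_matrix_zero_sym[OF cox datum that])
    fix i j assume ij: "i < n" "j < n"
    have \<alpha>: "\<alpha> i \<in> carrier V"
      using basis ij(1) by (auto simp: basis_def)
    show "\<rho> (s i) (\<alpha> j) = \<alpha> j \<oplus>\<^bsub>V\<^esub> (- 2 * ir_matrix n m k a $$ (i, j)) \<odot>\<^bsub>V\<^esub> \<alpha> i"
    proof (cases "i = j")
      case True
      \<comment> \<open>The diagonal entry 1 leaves the total coefficient 1 - 2 = -1.\<close>
      have "\<alpha> i \<oplus>\<^bsub>V\<^esub> (- 2) \<odot>\<^bsub>V\<^esub> \<alpha> i = (1 + - 2) \<odot>\<^bsub>V\<^esub> \<alpha> i"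
        using \<alpha> by (simp only: smult_class_ring)
      then show ?thesis
        using True ij def \<alpha> by (simp add: ir_defined_by_def ir_matrix_def minus_eq_smult)
    next
      case False
      have "- 2 * ir_matrix n m k a $$ (i, j) =
          2 * (a i j / a j i) * of_real (cos (real (k i j) * pi / real (m i j)))"
        using False ij by (simp add: ir_matrix_def)
      then show ?thesis
        using False ij def unfolding ir_defined_by_def by metis
    qed
  qed
qed

text \<open>Connectedness means strong connectedness of the symmetric closure. Its arcs lie in
  \<open>adjacency\<close> by the nonvanishing of the cosine, so its paths carry over; its nonempty
  vertex set gives \<open>0 < n\<close>.\<close>

lemma ir_graph_linked:
  assumes datum: "ir_datum n m k a"
    and rep: "reflection_rep W V \<rho> n s \<alpha> (ir_matrix n m k a)"
    and conn: "connected (with_proj (ir_graph n m k))"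
  shows "0 < n" and "i < n \<Longrightarrow> j < n \<Longrightarrow> (i, j) \<in> (reflection_rep.adjacency n (ir_matrix n m k a))\<^sup>*"
proof -
  interpret reflection_rep W V \<rho> n s \<alpha> "ir_matrix n m k a"
    by (rule rep)
  let ?G = "mk_symmetric (with_proj (ir_graph n m k))"
  have strong: "strongly_connected (with_proj ?G)" and verts: "verts (with_proj ?G) = {..<n}"
    using conn by (simp_all add: connected_def ir_graph_def)
  then show "0 < n"
    by (auto simp: strongly_connected_def)
  have edge: "(i, j) \<in> adjacency" "(j, i) \<in> adjacency"
    if "i < n" "j < n" "i \<noteq> j" "3 \<le> m i j div gcd (m i j) (k i j)" for i j
  proof -
    show "(i, j) \<in> adjacency"
      using ir_matrix_edge_nonzero[OF datum that] that(1,2) by (simp add: adjacency_def)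
    then show "(j, i) \<in> adjacency"
      using sym_adjacency by (rule symD[rotated])
  qed
  have "arcs_ends (with_proj ?G) \<subseteq> adjacency"
    by (auto simp: parcs_mk_symmetric ir_graph_def edge)
  then have mono: "(arcs_ends (with_proj ?G))\<^sup>* \<subseteq> adjacency\<^sup>*"
    by (rule rtrancl_mono)
  show "(i, j) \<in> adjacency\<^sup>*" if "i < n" "j < n"
  proof -
    have "i \<rightarrow>\<^sup>*\<^bsub>with_proj ?G\<^esub> j"
      using strong verts that by (simp add: strongly_connected_def)
    then show ?thesis
      using mono by (blast dest: reachable_rtranclI)
  qed
qed

theorem proposition5p6:
  fixes W :: "('g, 'a) monoid_scheme"
    and V :: "(complex, 'v, 'b) module_scheme"
    and \<rho> :: "'g \<Rightarrow> 'v \<Rightarrow> 'v"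
    and n :: nat
    and s :: "nat \<Rightarrow> 'g"
    and \<alpha> :: "nat \<Rightarrow> 'v"
    and m k :: "nat \<Rightarrow> nat \<Rightarrow> nat"
    and a :: "nat \<Rightarrow> nat \<Rightarrow> complex"
  assumes "coxeter_system W n s m"
    and "ir_datum n m k a"
    and "ir_representation W n s V \<rho> \<alpha>"
    and "ir_defined_by n s m V \<rho> \<alpha> k a"
  shows "(connected (with_proj (ir_graph n m k)) \<longrightarrow>
            (indecomposable_rep W V \<rho> \<and>
             (irreducible_rep W V \<rho> \<longleftrightarrow> invertible_mat (ir_matrix n m k a))) \<and>
            (\<not> irreducible_rep W V \<rho> \<longrightarrow>
               (\<forall>V\<^sub>0. maximal_subrep W V \<rho> V\<^sub>0 \<longrightarrow>
                  irreducible_rep W (quotient_space V V\<^sub>0) (quotient_action V V\<^sub>0 \<rho>) \<and>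
                  vectorspace.dim class_ring (quotient_space V V\<^sub>0) =
                    vec_space.rank n (ir_matrix n m k a)))) \<and>
         (semisimple_rep W V \<rho> \<longleftrightarrow> invertible_mat (ir_matrix n m k a))"
proof -
  interpret reflection_rep W V \<rho> n s \<alpha> "ir_matrix n m k a"
    by (rule ir_reflection_rep[OF assms])
  \<comment> \<open>Supplies both assumptions of the connected case, with connectedness of the graph
    left as a premise.\<close>
  note linked = ir_graph_linked[OF assms(2) reflection_rep_axioms]
  show ?thesis
    using indecomposable[OF linked] irreducible_iff[OF linked] maximal_subrep_eq[OF linked]
      quotient_irreducible dim_quotient_fixed_space semisimple_if_invertible invertible_if_semisimple
    by blast
qed

end
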